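(* Let $G,H$ be finite directed graphs and $\xi=(\xi^0,\xi^1)$ a pair of graph embeddings $H\to G$ satisfying the standing hypotheses, and let $(X_\xi^+,d_\xi)$ and $\sigma_\xi:X_\xi^+\to X_\xi^+$ be the associated metric space and map. If $x,y\in X^+_\xi$ satisfy $d_\xi(x,y)\le 2^{-2}$, then $$2\,d_\xi(x,y)\le d_\xi(\sigma_\xi(x),\sigma_\xi(y))\le 8\,d_\xi(x,y).$$
   Context: **Graphs.** A finite directed graph $G$ consists of finite sets $G^0$ (vertices), $G^1$ (edges) and maps $i,t:G^1\to G^0$ (initial and terminal vertex). $G$ is primitive if there is $k\ge1$ such that for all $v,w\in G^0$ there is a path of length $k$ from $v$ to $w$. $X_G^+$ is the set of sequences $x=(x_n)_{n\ge1}$ in $G^1$ with $t(x_n)=i(x_{n+1})$ for all $n$, with metric $d_G(x,y)=\inf\{2^{-n}: n\ge0,\ x_j=y_j \text{ for }1\le j\le n\}$ and shift $\sigma(x)_n=x_{n+1}$. A graph embedding $H\to G$ is an injective map sending $H^0$ into $G^0$ and $H^1$ into $G^1$ and commuting with $i$ and $t$. **Standing hypotheses** on $(G,H,\xi^0,\xi^1)$: $G$ is primitive; $\xi^0|_{H^0}=\xi^1|_{H^0}$; $\xi^0(H^1)\cap\xi^1(H^1)=\emptyset$; for every $y\in H^1$ there is $x\in G^1\setminus(\xi^0(H^1)\cup\xi^1(H^1))$ with $i(x)=i(\xi^0(y))$, $t(x)=t(\xi^0(y))$. **Notation.** $\xi(H^1)=\xi^0(H^1)\cup\xi^1(H^1)$;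 for $x\in\xi(H^1)$, $\varepsilon(x)\in\{0,1\}$ is such that $x\in\xi^{\varepsilon(x)}(H^1)$. $G_\xi$ is the graph with vertex set $G^0$ and edge set obtained from $G^1$ by identifying $\xi^0(y)$ with $\xi^1(y)$ for each $y\in H^1$; $\tau_\xi$ denotes the quotient map $G^1\to G_\xi^1$ and the induced map $X_G^+\to X_{G_\xi}^+$. For $x\in X_G^+$, $\kappa(x)\in\{0,1,\dots,\infty\}$ is the number of $n\ge1$ with $x_n\notin\xi(H^1)$; $X_k^+=\kappa^{-1}\{k\}$; if $\kappa(x)>0$, $n(x)$ is the least $n\ge 1$ with $x_n\notin\xi(H^1)$. **The relation $\sim_\xi$ on $X_G^+$.** $x\sim_\xi x$ for all $x$; and $x\sim_\xi x'$ if either (1) for some $n\ge1$, $j\in\{0,1\}$, $y_n,y_{n+1},\ldots\in H^1$: $x=(x_1,\dots,x_{n-1},\xi^{1-j}(y_n),\xi^j(y_{n+1}),\xi^j(y_{n+2}),\dots)$ and $x'=(x_1,\dots,x_{n-1},\xi^{j}(y_n),\xi^{1-j}(y_{n+1}),\xi^{1-j}(y_{n+2}),\dots)$; or (2) for some $n\ge0$, $j\in\{0,1\}$, $y_{n+1},y_{n+2},\ldots\in H^1$, where $n=0$ or $x_n\notin\xi(H^1)$: $x=(x_1,\dots,x_n,\xi^j(y_{n+1}),\xi^j(y_{n+2}),\dots)$ and $x'=(x_1,\dots,x_n,\xi^{1-j}(y_{n+1}),\xi^{1-j}(y_{n+2}),\dots)$. This is an equivalence relation. $X_\xi^+=X_G^+/\sim_\xi$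 with the quotient topology, $\pi_\xi:X_G^+\to X_\xi^+$ is the quotient map, and $\sigma_\xi(\pi_\xi(x))=\pi_\xi(\sigma(x))$ (well defined). **The metric.** On the unit circle $\mathbb T\subset\mathbb C$ let $d_{\mathbb T}(z,w)=\inf\{|s|: s\in\mathbb R,\ e^{2\pi i s}z=w\}$. For $x\in X_G^+$, $\theta(x)=\exp(2\pi i\sum_{j\ge1}\varepsilon(x_j)2^{-j})$ if $\kappa(x)=0$ and $\theta(x)=\exp(2\pi i\sum_{j=1}^{n(x)-1}\varepsilon(x_j)2^{-j})$ if $\kappa(x)>0$. Define $\lambda_k:X_k^+\times X_k^+\to[0,\infty)$ by $\lambda_0(x,y)=d_{\mathbb T}(\theta(x),\theta(y))$ and, for $k\ge1$, $\lambda_k(x,y)=|2^{-n(x)}-2^{-n(y)}|+d_{\mathbb T}(\theta(x),\theta(y))+\delta\,2^{-2-n(x)}\lambda_{k-1}(\sigma^{n(x)}(x),\sigma^{n(y)}(y))$, where $\delta=1$ if $(n(x),\theta(x))=(n(y),\theta(y))$ and $\delta=0$ otherwise. Put $d_k(x,y)=d_{G_\xi}(\tau_\xi(x),\tau_\xi(y))+\lambda_k(x,y)$ on $X_k^+$. The $d_k$, $0\le k<\infty$, have a common continuous extension to a pseudo-metric $d$ on $X_G^+$, given by $d(x,y)=\lim_l d_l(x^l,y^l)$ for any $x^l,y^l\in X_l^+$ with $x^l\to x$, $y^l\to y$ in $d_G$. One has $d(x,y)=0$ iff $x\sim_\xi y$, and $d_\xi(\pi_\xi(x),\pi_\xi(y))=d(x,y)$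 defines a metric on $X_\xi^+$ inducing its topology. *)

theory Defs
  imports
    Complex_Main
    "HOL-Library.Extended_Nat"
    "Graph_Theory.Arc_Walk"
begin

section \<open>Graphs and path spaces\<close>

text \<open>
  A finite directed graph (loops and multiple edges allowed) is a \<^term>\<open>fin_digraph\<close>;
  the initial and terminal vertex maps are \<^const>\<open>tail\<close> and \<^const>\<open>head\<close>.
\<close>

definition primitive_digraph :: "('v, 'e) pre_digraph \<Rightarrow> bool" where
  "primitive_digraph G \<longleftrightarrow>
     (\<exists>k\<ge>1. \<forall>v\<in>verts G. \<forall>w\<in>verts G. \<exists>p. pre_digraph.awalk G v p w \<and> length p = k)"

record ('w, 'f, 'v, 'e) graph_map =
  on_verts :: "'w \<Rightarrow> 'v"
  on_arcs :: "'f \<Rightarrow> 'e"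

definition graph_embedding ::
  "('w, 'f) pre_digraph \<Rightarrow> ('v, 'e) pre_digraph \<Rightarrow> ('w, 'f, 'v, 'e) graph_map \<Rightarrow> bool" where
  "graph_embedding H G f \<longleftrightarrow>
     inj_on (on_verts f) (verts H) \<and> on_verts f ` verts H \<subseteq> verts G \<and>
     inj_on (on_arcs f) (arcs H) \<and> on_arcs f ` arcs H \<subseteq> arcs G \<and>
     (\<forall>y\<in>arcs H. tail G (on_arcs f y) = on_verts f (tail H y) \<and>
                  head G (on_arcs f y) = on_verts f (head H y))"

text \<open>
  Sequences are indexed from 0: the mathematical entry $x_{n+1}$, $n \ge 0$, is \<^term>\<open>x n\<close>
  here.
\<close>

definition path_space :: "('v, 'e) pre_digraph \<Rightarrow> (nat \<Rightarrow> 'e) set" where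
  "path_space G = {x. \<forall>n. x n \<in> arcs G \<and> head G (x n) = tail G (x (Suc n))}"

definition seq_dist :: "(nat \<Rightarrow> 'a) \<Rightarrow> (nat \<Rightarrow> 'a) \<Rightarrow> real" where
  "seq_dist x y = Inf {(1 / 2) ^ n | n. \<forall>j<n. x j = y j}"

definition shift :: "(nat \<Rightarrow> 'a) \<Rightarrow> nat \<Rightarrow> 'a" where
  "shift x = (\<lambda>n. x (Suc n))"

section \<open>The pair of embeddings\<close>

text \<open>
  The superscript set $\{0,1\}$ is rendered by \<^typ>\<open>bool\<close>: \<^term>\<open>xi False\<close> is $\xi^0$,
  \<^term>\<open>xi True\<close> is $\xi^1$, and $1-j$ becomes \<^term>\<open>\<not> j\<close>.
\<close>

definition xi_arcs ::
  "('w, 'f) pre_digraph \<Rightarrow> (bool \<Rightarrow> ('w, 'f, 'v, 'e) graph_map) \<Rightarrow> 'e set" where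
  "xi_arcs H xi = on_arcs (xi False) ` arcs H \<union> on_arcs (xi True) ` arcs H"

definition standing_hypotheses ::
  "('v, 'e) pre_digraph \<Rightarrow> ('w, 'f) pre_digraph \<Rightarrow> (bool \<Rightarrow> ('w, 'f, 'v, 'e) graph_map) \<Rightarrow> bool"
where
  "standing_hypotheses G H xi \<longleftrightarrow>
     primitive_digraph G \<and>
     (\<forall>v\<in>verts H. on_verts (xi False) v = on_verts (xi True) v) \<and>
     on_arcs (xi False) ` arcs H \<inter> on_arcs (xi True) ` arcs H = {} \<and>
     (\<forall>y\<in>arcs H. \<exists>x\<in>arcs G - xi_arcs H xi.
        tail G x = tail G (on_arcs (xi False) y) \<and> head G x = head G (on_arcs (xi False) y))"

text \<open>Only meaningful on \<^term>\<open>xi_arcs H xi\<close>.\<close>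
definition eps ::
  "('w, 'f) pre_digraph \<Rightarrow> (bool \<Rightarrow> ('w, 'f, 'v, 'e) graph_map) \<Rightarrow> 'e \<Rightarrow> bool" where
  "eps H xi e = (THE j. e \<in> on_arcs (xi j) ` arcs H)"

text \<open>
  Under the standing hypotheses this relation on the edges of \<^term>\<open>G\<close> is already an
  equivalence relation, because the two embeddings are injective with disjoint ranges.
\<close>
definition arc_ident ::
  "('v, 'e) pre_digraph \<Rightarrow> ('w, 'f) pre_digraph \<Rightarrow> (bool \<Rightarrow> ('w, 'f, 'v, 'e) graph_map)
    \<Rightarrow> ('e \<times> 'e) set" where
  "arc_ident G H xi = {(e, e'). e \<in> arcs G \<and> e' \<in> arcs G \<and>
     (e = e' \<or> (\<exists>y\<in>arcs H. \<exists>j. e = on_arcs (xi j) y \<and> e' = on_arcs (xi (\<not> j)) y))}"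

definition tau ::
  "('v, 'e) pre_digraph \<Rightarrow> ('w, 'f) pre_digraph \<Rightarrow> (bool \<Rightarrow> ('w, 'f, 'v, 'e) graph_map)
    \<Rightarrow> 'e \<Rightarrow> 'e set" where
  "tau G H xi e = arc_ident G H xi `` {e}"

definition quot_graph ::
  "('v, 'e) pre_digraph \<Rightarrow> ('w, 'f) pre_digraph \<Rightarrow> (bool \<Rightarrow> ('w, 'f, 'v, 'e) graph_map)
    \<Rightarrow> ('v, 'e set) pre_digraph" where
  "quot_graph G H xi =
     \<lparr>verts = verts G, arcs = arcs G // arc_ident G H xi,
      tail = (\<lambda>A. the_elem (tail G ` A)), head = (\<lambda>A. the_elem (head G ` A))\<rparr>"

section \<open>The quotient space\<close>

definition xi_step1 ::
  "('w, 'f) pre_digraph \<Rightarrow> (bool \<Rightarrow> ('w, 'f, 'v, 'e) graph_map)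
    \<Rightarrow> (nat \<Rightarrow> 'e) \<Rightarrow> (nat \<Rightarrow> 'e) \<Rightarrow> bool" where
  "xi_step1 H xi x x' \<longleftrightarrow>
     (\<exists>m j y. (\<forall>k\<ge>m. y k \<in> arcs H) \<and> (\<forall>k<m. x k = x' k) \<and>
        x m = on_arcs (xi (\<not> j)) (y m) \<and> x' m = on_arcs (xi j) (y m) \<and>
        (\<forall>k>m. x k = on_arcs (xi j) (y k) \<and> x' k = on_arcs (xi (\<not> j)) (y k)))"

definition xi_step2 ::
  "('w, 'f) pre_digraph \<Rightarrow> (bool \<Rightarrow> ('w, 'f, 'v, 'e) graph_map)
    \<Rightarrow> (nat \<Rightarrow> 'e) \<Rightarrow> (nat \<Rightarrow> 'e) \<Rightarrow> bool" where
  "xi_step2 H xi x x' \<longleftrightarrow>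
     (\<exists>n j y. (\<forall>k\<ge>n. y k \<in> arcs H) \<and> (n = 0 \<or> x (n - 1) \<notin> xi_arcs H xi) \<and>
        (\<forall>k<n. x k = x' k) \<and>
        (\<forall>k\<ge>n. x k = on_arcs (xi j) (y k) \<and> x' k = on_arcs (xi (\<not> j)) (y k)))"

definition xi_rel ::
  "('v, 'e) pre_digraph \<Rightarrow> ('w, 'f) pre_digraph \<Rightarrow> (bool \<Rightarrow> ('w, 'f, 'v, 'e) graph_map)
    \<Rightarrow> ((nat \<Rightarrow> 'e) \<times> (nat \<Rightarrow> 'e)) set" where
  "xi_rel G H xi = {(x, x'). x \<in> path_space G \<and> x' \<in> path_space G \<and>
     (x = x' \<or> xi_step1 H xi x x' \<or> xi_step2 H xi x x')}"

definition xi_space ::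
  "('v, 'e) pre_digraph \<Rightarrow> ('w, 'f) pre_digraph \<Rightarrow> (bool \<Rightarrow> ('w, 'f, 'v, 'e) graph_map)
    \<Rightarrow> (nat \<Rightarrow> 'e) set set" where
  "xi_space G H xi = path_space G // xi_rel G H xi"

definition xi_proj ::
  "('v, 'e) pre_digraph \<Rightarrow> ('w, 'f) pre_digraph \<Rightarrow> (bool \<Rightarrow> ('w, 'f, 'v, 'e) graph_map)
    \<Rightarrow> (nat \<Rightarrow> 'e) \<Rightarrow> (nat \<Rightarrow> 'e) set" where
  "xi_proj G H xi x = xi_rel G H xi `` {x}"

definition xi_shift ::
  "('v, 'e) pre_digraph \<Rightarrow> ('w, 'f) pre_digraph \<Rightarrow> (bool \<Rightarrow> ('w, 'f, 'v, 'e) graph_map)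
    \<Rightarrow> (nat \<Rightarrow> 'e) set \<Rightarrow> (nat \<Rightarrow> 'e) set" where
  "xi_shift G H xi A = the_elem {xi_proj G H xi (shift x) | x. x \<in> A}"

section \<open>The metric\<close>

definition circ_dist :: "complex \<Rightarrow> complex \<Rightarrow> real" where
  "circ_dist z w = Inf {\<bar>s\<bar> | s :: real. exp (2 * of_real pi * \<i> * of_real s) * z = w}"

definition kappa ::
  "('w, 'f) pre_digraph \<Rightarrow> (bool \<Rightarrow> ('w, 'f, 'v, 'e) graph_map) \<Rightarrow> (nat \<Rightarrow> 'e) \<Rightarrow> enat" where
  "kappa H xi x =
     (let S = {n. x n \<notin> xi_arcs H xi} in if finite S then enat (card S) else \<infinity>)"

definition level ::
  "('v, 'e) pre_digraph \<Rightarrow> ('w, 'f) pre_digraph \<Rightarrow> (bool \<Rightarrow> ('w, 'f, 'v, 'e) graph_map)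
    \<Rightarrow> nat \<Rightarrow> (nat \<Rightarrow> 'e) set" where
  "level G H xi k = {x \<in> path_space G. kappa H xi x = enat k}"

text \<open>
  The least $n \ge 1$ with $x_n \notin \xi(H^1)$; only meaningful if
  \<^term>\<open>kappa H xi x > 0\<close>. The successor accounts for indexing from 0.
\<close>
definition first_free ::
  "('w, 'f) pre_digraph \<Rightarrow> (bool \<Rightarrow> ('w, 'f, 'v, 'e) graph_map) \<Rightarrow> (nat \<Rightarrow> 'e) \<Rightarrow> nat" where
  "first_free H xi x = Suc (LEAST m. x m \<notin> xi_arcs H xi)"

definition theta ::
  "('w, 'f) pre_digraph \<Rightarrow> (bool \<Rightarrow> ('w, 'f, 'v, 'e) graph_map) \<Rightarrow> (nat \<Rightarrow> 'e) \<Rightarrow> complex" where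
  "theta H xi x = exp (2 * of_real pi * \<i> * of_real
     (if kappa H xi x = 0 then (\<Sum>j. of_bool (eps H xi (x j)) / 2 ^ Suc j)
      else (\<Sum>j < first_free H xi x - 1. of_bool (eps H xi (x j)) / 2 ^ Suc j)))"

primrec lam ::
  "('w, 'f) pre_digraph \<Rightarrow> (bool \<Rightarrow> ('w, 'f, 'v, 'e) graph_map)
    \<Rightarrow> nat \<Rightarrow> (nat \<Rightarrow> 'e) \<Rightarrow> (nat \<Rightarrow> 'e) \<Rightarrow> real" where
  "lam H xi 0 = (\<lambda>x y. circ_dist (theta H xi x) (theta H xi y))"
| "lam H xi (Suc k) = (\<lambda>x y.
     \<bar>(1 / 2) ^ first_free H xi x - (1 / 2) ^ first_free H xi y\<bar>
     + circ_dist (theta H xi x) (theta H xi y)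
     + (if first_free H xi x = first_free H xi y \<and> theta H xi x = theta H xi y then 1 else 0)
       * (1 / 2) ^ (2 + first_free H xi x)
       * lam H xi k ((shift ^^ first_free H xi x) x) ((shift ^^ first_free H xi y) y))"

definition level_dist ::
  "('v, 'e) pre_digraph \<Rightarrow> ('w, 'f) pre_digraph \<Rightarrow> (bool \<Rightarrow> ('w, 'f, 'v, 'e) graph_map)
    \<Rightarrow> nat \<Rightarrow> (nat \<Rightarrow> 'e) \<Rightarrow> (nat \<Rightarrow> 'e) \<Rightarrow> real" where
  "level_dist G H xi k x y =
     seq_dist (\<lambda>n. tau G H xi (x n)) (\<lambda>n. tau G H xi (y n)) + lam H xi k x y"

text \<open>
  The sequences $x^l \in X_l^+$, $x^l \to x$, along which $d$ is computed. Such sequences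
  exist for every \<^term>\<open>x\<close> as soon as $X_0^+ \neq \emptyset$, i.e. as soon as
  \<^term>\<open>H\<close> contains an infinite path. If \<^term>\<open>H\<close> contains none, then every $X_k^+$ with
  $k < \infty$ is empty, so $\kappa = \infty$ everywhere; in this degenerate case we take
  $x^l = x$, which makes sense because the formula for $\lambda_l(x,y)$ only requires
  $\kappa(x), \kappa(y) \ge l$.
\<close>
definition approximates ::
  "('v, 'e) pre_digraph \<Rightarrow> ('w, 'f) pre_digraph \<Rightarrow> (bool \<Rightarrow> ('w, 'f, 'v, 'e) graph_map)
    \<Rightarrow> (nat \<Rightarrow> nat \<Rightarrow> 'e) \<Rightarrow> (nat \<Rightarrow> 'e) \<Rightarrow> bool" where
  "approximates G H xi xs x \<longleftrightarrow>
     (if level G H xi 0 = {} then xs = (\<lambda>l. x)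
      else (\<forall>l. xs l \<in> level G H xi l) \<and> (\<lambda>l. seq_dist (xs l) x) \<longlonglongrightarrow> 0)"

definition path_dist ::
  "('v, 'e) pre_digraph \<Rightarrow> ('w, 'f) pre_digraph \<Rightarrow> (bool \<Rightarrow> ('w, 'f, 'v, 'e) graph_map)
    \<Rightarrow> (nat \<Rightarrow> 'e) \<Rightarrow> (nat \<Rightarrow> 'e) \<Rightarrow> real" where
  "path_dist G H xi x y = (THE r. \<forall>xs ys. approximates G H xi xs x \<longrightarrow> approximates G H xi ys y
     \<longrightarrow> (\<lambda>l. level_dist G H xi l (xs l) (ys l)) \<longlonglongrightarrow> r)"

definition xi_dist ::
  "('v, 'e) pre_digraph \<Rightarrow> ('w, 'f) pre_digraph \<Rightarrow> (bool \<Rightarrow> ('w, 'f, 'v, 'e) graph_map)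
    \<Rightarrow> (nat \<Rightarrow> 'e) set \<Rightarrow> (nat \<Rightarrow> 'e) set \<Rightarrow> real" where
  "xi_dist G H xi A B = the_elem {path_dist G H xi x y | x y. x \<in> A \<and> y \<in> B}"

section \<open>Consistency of the edge identification\<close>

lemma equiv_arc_ident:
  assumes emb: "\<And>j. graph_embedding H G (xi j)" and hyp: "standing_hypotheses G H xi"
  shows "equiv (arcs G) (arc_ident G H xi)"
proof (rule equivI)
  have inj: "y = z" if "on_arcs (xi j) y = on_arcs (xi j) z" "y \<in> arcs H" "z \<in> arcs H" for j y z
    using emb[of j] that by (auto simp: graph_embedding_def dest: inj_onD)
  have disj: "on_arcs (xi j) y \<noteq> on_arcs (xi (\<not> j)) z" if "y \<in> arcs H" "z \<in> arcs H" for j y z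
    using hyp that by (cases j) (auto simp: standing_hypotheses_def)
  show "arc_ident G H xi \<subseteq> arcs G \<times> arcs G" by (auto simp: arc_ident_def)
  show "refl_on (arcs G) (arc_ident G H xi)" by (auto simp: refl_on_def arc_ident_def)
  show "sym (arc_ident G H xi)"
  proof (rule symI)
    fix a b assume ab: "(a, b) \<in> arc_ident G H xi"
    have "(on_arcs (xi (\<not> j)) y, on_arcs (xi j) y) \<in> arc_ident G H xi"
      if "y \<in> arcs H" "on_arcs (xi j) y \<in> arcs G" "on_arcs (xi (\<not> j)) y \<in> arcs G" for j y
      using that unfolding arc_ident_def by (auto intro!: bexI[of _ y] exI[of _ "\<not> j"])
    note swap = this
    show "(b, a) \<in> arc_ident G H xi"
    proof (cases "a = b")
      case True
      with ab show ?thesis by simp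
    next
      case False
      from ab have ar: "a \<in> arcs G" "b \<in> arcs G" by (simp_all add: arc_ident_def)
      from ab False obtain y j where "y \<in> arcs H" "a = on_arcs (xi j) y" "b = on_arcs (xi (\<not> j)) y"
        unfolding arc_ident_def by blast
      with ar swap show ?thesis by simp
    qed
  qed
  show "trans (arc_ident G H xi)"
  proof (rule transI)
    fix a b c assume ab: "(a, b) \<in> arc_ident G H xi" and bc: "(b, c) \<in> arc_ident G H xi"
    show "(a, c) \<in> arc_ident G H xi"
    proof (cases "a = b \<or> b = c")
      case True
      with ab bc show ?thesis by auto
    next
      case False
      from ab False obtain y j where y: "y \<in> arcs H" "a = on_arcs (xi j) y" "b = on_arcs (xi (\<not> j)) y"
        unfolding arc_ident_def by blast
      from bc False obtain z k where z: "z \<in> arcs H" "b = on_arcs (xi k) z" "c = on_arcs (xi (\<not> k)) z"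
        unfolding arc_ident_def by blast
      have k: "k = (\<not> j)"
        using disj[OF z(1) y(1), of j] y(3) z(2) by (cases "k = j") auto
      then have "z = y" using inj[of "\<not> j" z y] y z by simp
      then have "a = c" using y z k by simp
      then show ?thesis using ab by (auto simp: arc_ident_def)
    qed
  qed
qed

lemma tau_path:
  assumes emb: "\<And>j. graph_embedding H G (xi j)" and hyp: "standing_hypotheses G H xi"
    and H: "wf_digraph H" and x: "x \<in> path_space G"
  shows "(\<lambda>n. tau G H xi (x n)) \<in> path_space (quot_graph G H xi)"
proof -
  have xi_eq: "on_verts (xi j) v = on_verts (xi k) v" if "v \<in> verts H" for j k v
    using hyp that by (cases j; cases k) (auto simp: standing_hypotheses_def)
  have ends: "tail G (on_arcs (xi j) z) = on_verts (xi j) (tail H z)"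
    "head G (on_arcs (xi j) z) = on_verts (xi j) (head H z)" if "z \<in> arcs H" for j z
    using emb[of j] that by (simp_all add: graph_embedding_def)
  have "tail G e' = tail G e \<and> head G e' = head G e" if r: "(e, e') \<in> arc_ident G H xi" for e e'
  proof (cases "e = e'")
    case False
    from r False obtain z j where z: "z \<in> arcs H" "e = on_arcs (xi j) z" "e' = on_arcs (xi (\<not> j)) z"
      unfolding arc_ident_def by blast
    then show ?thesis
      using ends[OF z(1), of j] ends[OF z(1), of "\<not> j"] wf_digraph.wellformed[OF H z(1)]
        xi_eq[of "tail H z" "\<not> j" j] xi_eq[of "head H z" "\<not> j" j] by simp
  qed simp
  moreover have "e \<in> tau G H xi e" if "e \<in> arcs G" for e
    using that by (auto simp: tau_def arc_ident_def)
  ultimately have im: "tail G ` tau G H xi e = {tail G e} \<and> head G ` tau G H xi e = {head G e}"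
    if "e \<in> arcs G" for e
    using that unfolding tau_def by blast
  have cl: "tau G H xi e \<in> arcs G // arc_ident G H xi" if "e \<in> arcs G" for e
    using that by (simp add: tau_def quotientI)
  from x show ?thesis
    by (simp add: path_space_def quot_graph_def im cl)
qed

end

theory Submission
  imports Defs
begin

text \<open>
  The sequence part of the metric doubles under the shift as soon as the first edges agree in the
  quotient graph, so everything depends on the functions \<open>\<lambda>\<^sub>k\<close>. If the first edges lie outside
  \<open>\<xi>(H\<^sup>1)\<close>, then the definition of \<open>\<lambda>\<^sub>k\<close> says directly that passing from \<open>(k, x, y)\<close> to
  \<open>(k - 1, \<sigma> x, \<sigma> y)\<close> multiplies the value by 8. If they lie in \<open>\<xi>(H\<^sup>1)\<close>, then \<open>\<theta>(\<sigma> x) = \<theta>(x)\<^sup>2\<close>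
  and \<open>n(\<sigma> x) = n(x) - 1\<close>, so \<open>\<lambda>\<^sub>k\<close> doubles because squaring doubles arcs of length at most 1/4.
  To pass to the limit one needs that \<open>\<lambda>\<^sub>k(x, y)\<close> depends on \<open>k\<close>, \<open>x\<close> and \<open>y\<close> in a uniformly
  continuous way, up to equivalence: an error of order \<open>2\<^sup>-\<^sup>m\<close> in one block is damped by the factor
  \<open>2\<^sup>-\<^sup>2\<^sup>-\<^sup>n\<close> in front of the next one. Primitivity and the third standing hypothesis provide the
  sequences along which the limit is taken.
\<close>

section \<open>Distance to the nearest integer\<close>

text \<open>The circle metric in terms of angles counted in full turns; \<open>circ_dist_exp\<close>
  makes the link. Estimates for \<open>lam\<close> thereby become real arithmetic.\<close>

definition turn_dist :: "real \<Rightarrow> real" where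
  "turn_dist t = \<bar>t - of_int (round t)\<bar>"

lemma turn_dist_le: "turn_dist t \<le> \<bar>t - of_int n\<bar>"
  unfolding turn_dist_def by (rule round_diff_minimal)

lemma turn_dist_nonneg [simp]: "0 \<le> turn_dist t"
  by (simp add: turn_dist_def)

lemma turn_dist_le_half: "turn_dist t \<le> 1 / 2"
  using of_int_round_abs_le[of t] by (simp add: turn_dist_def abs_minus_commute)

lemma turn_dist_le_abs: "turn_dist t \<le> \<bar>t\<bar>"
  using turn_dist_le[of t 0] by simp

lemma turn_dist_add: "turn_dist (s + t) \<le> turn_dist s + turn_dist t"
  using turn_dist_le[of "s + t" "round s + round t"] by (simp add: turn_dist_def)

lemma turn_dist_minus: "turn_dist (- t) = turn_dist t"
proof -
  have "turn_dist (- t) \<le> turn_dist t" for t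
    using turn_dist_le[of "- t" "- round t"] by (simp add: turn_dist_def)
  from this[of t] this[of "- t"] show ?thesis by simp
qed

lemma turn_dist_diff_int: "turn_dist (t - of_int n) = turn_dist t"
proof -
  have "turn_dist (t - of_int n) \<le> turn_dist t" for t n
    using turn_dist_le[of "t - of_int n" "round t - n"] by (simp add: turn_dist_def)
  from this[of t n] this[of "t - of_int n" "- n"] show ?thesis by simp
qed

lemma turn_dist_double_le: "turn_dist (2 * t) \<le> 2 * turn_dist t"
  using turn_dist_add[of t t] by simp

text \<open>Up to \<open>1/4\<close> doubling an angle doubles its distance \<open>r\<close> from
  the integers; between \<open>1/4\<close> and \<open>1/2\<close> the result is
  \<open>1 - 2 * r\<close>, which falls short of \<open>2 * r\<close> by \<open>4 * r - 1\<close>.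
  The correction is continuous in \<open>r\<close>, so the bound survives a passage to the
  limit.\<close>

lemma turn_dist_double_ge:
  "2 * turn_dist t - max 0 (4 * turn_dist t - 1) \<le> turn_dist (2 * t)"
proof -
  define m r where "m = round (2 * t)" and "r = round t"
  have eq: "turn_dist (2 * t) = \<bar>2 * (t - of_int r) - of_int (m - 2 * r)\<bar>"
    by (simp add: turn_dist_def m_def algebra_simps)
  show ?thesis
  proof (cases "m = 2 * r")
    case True
    with eq have "turn_dist (2 * t) = 2 * \<bar>t - of_int r\<bar>"
      by (simp del: right_diff_distrib_numeral add: abs_mult)
    then show ?thesis by (simp add: turn_dist_def[of t] r_def[symmetric])
  next
    case False
    \<comment> \<open>The integer nearest to \<open>2 * (t - r)\<close> is nonzero here, and every
      nonzero integer has distance at least \<open>1 - 2 * \<bar>t - r\<bar>\<close> from that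
      number.\<close>
    then have "1 \<le> \<bar>m - 2 * r\<bar>" by linarith
    then have "1 \<le> \<bar>of_int (m - 2 * r) :: real\<bar>" by linarith
    moreover have "1 - 2 * \<bar>a\<bar> \<le> \<bar>2 * a - b\<bar>" if "1 \<le> \<bar>b\<bar>" for a b :: real
      using that by (auto simp: abs_if split: if_splits)
    ultimately have "1 - 2 * \<bar>t - of_int r\<bar> \<le> turn_dist (2 * t)"
      unfolding eq by blast
    then show ?thesis by (simp add: turn_dist_def r_def[symmetric] max_def)
  qed
qed

section \<open>Points of the circle and their angles\<close>

lemma exp_turn_eq_1_iff:
  "exp (2 * of_real pi * \<i> * of_real t) = (1 :: complex) \<longleftrightarrow> (\<exists>n :: int. t = of_int n)"
proof -
  have "exp (2 * of_real pi * \<i> * of_real t) = cis (2 * pi * t)"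
    by (simp add: cis_conv_exp algebra_simps)
  moreover have "cis (2 * pi * t) = 1 \<longleftrightarrow> cos (2 * pi * t) = 1"
    by (auto simp: complex_eq_iff intro: cos_one_sin_zero)
  moreover have "cos (2 * pi * t) = 1 \<longleftrightarrow> (\<exists>n :: int. t = of_int n)"
    by (simp add: cos_one_2pi_int)
  ultimately show ?thesis by simp
qed

lemma exp_turn_eq_iff:
  "exp (2 * of_real pi * \<i> * of_real s) = exp (2 * of_real pi * \<i> * (of_real t :: complex))
     \<longleftrightarrow> (\<exists>n :: int. s - t = of_int n)"
proof -
  have "exp (2 * of_real pi * \<i> * of_real s) = exp (2 * of_real pi * \<i> * (of_real t :: complex))
      \<longleftrightarrow> exp (2 * of_real pi * \<i> * (of_real (s - t) :: complex)) = 1"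
    by (simp add: exp_diff right_diff_distrib)
  then show ?thesis by (simp only: exp_turn_eq_1_iff)
qed

text \<open>The rotations taking one point to the other are exactly by \<open>b - a - n\<close>
  turns with \<open>n\<close> an integer, and the infimum is attained at the nearest
  integer.\<close>

lemma circ_dist_exp:
  "circ_dist (exp (2 * of_real pi * \<i> * of_real a)) (exp (2 * of_real pi * \<i> * of_real b))
     = turn_dist (b - a)"
proof -
  have mult: "exp (2 * of_real pi * \<i> * of_real s) * exp (2 * of_real pi * \<i> * of_real a)
      = exp (2 * of_real pi * \<i> * (of_real (s + a) :: complex))" for s
    by (simp add: exp_add[symmetric] algebra_simps)
  have "{\<bar>s\<bar> | s :: real. exp (2 * of_real pi * \<i> * of_real s) * exp (2 * of_real pi * \<i> * of_real a)
      = exp (2 * of_real pi * \<i> * of_real b)} = {\<bar>b - a - of_int n\<bar> | n :: int. True}"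
    (is "?S = ?T")
  proof (intro set_eqI iffI)
    fix r assume "r \<in> ?S"
    then obtain s n where "r = \<bar>s\<bar>" "s + a - b = of_int n"
      unfolding mult exp_turn_eq_iff by blast
    then have "r = \<bar>b - a - of_int (- n)\<bar>" by simp
    then show "r \<in> ?T" by blast
  next
    fix r assume "r \<in> ?T"
    then obtain n where "r = \<bar>b - a - of_int n\<bar>" by blast
    moreover have "(b - a - of_int n) + a - b = of_int (- n)" by simp
    ultimately show "r \<in> ?S"
      unfolding mult exp_turn_eq_iff by blast
  qed
  moreover have "Inf ?T = turn_dist (b - a)"
  proof (rule cInf_eq_minimum)
    show "turn_dist (b - a) \<in> ?T" by (auto simp: turn_dist_def)
    show "turn_dist (b - a) \<le> r" if "r \<in> ?T" for r using that turn_dist_le by auto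
  qed
  ultimately show ?thesis by (simp add: circ_dist_def)
qed

lemma turn_dist_eq_0_iff: "turn_dist t = 0 \<longleftrightarrow> (\<exists>n :: int. t = of_int n)"
  using turn_dist_le[of t] by (fastforce simp: turn_dist_def)

lemma exp_turn_eq_iff_turn_dist:
  "exp (2 * of_real pi * \<i> * of_real s) = exp (2 * of_real pi * \<i> * (of_real t :: complex))
     \<longleftrightarrow> turn_dist (t - s) = 0"
  by (subst exp_turn_eq_iff) (metis minus_diff_eq turn_dist_eq_0_iff turn_dist_minus)

section \<open>The sequence metric\<close>

lemma seq_dist_same [simp]: "seq_dist x x = 0"
proof -
  have "(INF n. (1 / 2 :: real) ^ n) = 0"
  proof (rule antisym)
    have bdd: "bdd_below (range (\<lambda>n. (1 / 2 :: real) ^ n))" by (rule bdd_belowI[of _ 0]) auto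
    show "(INF n. (1 / 2 :: real) ^ n) \<le> 0"
    proof (rule LIMSEQ_le_const[of "\<lambda>n. (1 / 2 :: real) ^ n"])
      show "(\<lambda>n. (1 / 2 :: real) ^ n) \<longlonglongrightarrow> 0" by (rule LIMSEQ_realpow_zero) auto
    qed (use bdd in \<open>auto intro: cINF_lower\<close>)
    show "0 \<le> (INF n. (1 / 2 :: real) ^ n)" by (rule cINF_greatest) auto
  qed
  then show ?thesis by (simp add: seq_dist_def full_SetCompr_eq)
qed

lemma seq_dist_eq:
  assumes "x \<noteq> y"
  shows "seq_dist x y = (1 / 2) ^ (LEAST n. x n \<noteq> y n)"
  unfolding seq_dist_def
proof (rule cInf_eq_minimum)
  let ?n = "LEAST n. x n \<noteq> y n"
  show "(1 / 2) ^ ?n \<in> {(1 / 2 :: real) ^ n | n. \<forall>j<n. x j = y j}"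
    using not_less_Least by blast
  fix r assume "r \<in> {(1 / 2 :: real) ^ n | n. \<forall>j<n. x j = y j}"
  then obtain n where n: "r = (1 / 2) ^ n" "\<forall>j<n. x j = y j" by blast
  have "x ?n \<noteq> y ?n" by (rule LeastI_ex) (use assms in blast)
  then have "n \<le> ?n" using n by (meson not_less)
  then show "(1 / 2) ^ ?n \<le> r" using n by (simp add: power_decreasing)
qed

lemma seq_dist_nonneg [simp]: "0 \<le> seq_dist x y"
  by (cases "x = y") (simp_all add: seq_dist_eq)

lemma seq_dist_le:
  assumes "\<forall>j<m. x j = y j" shows "seq_dist x y \<le> (1 / 2) ^ m"
proof (cases "x = y")
  case False
  have "x (LEAST n. x n \<noteq> y n) \<noteq> y (LEAST n. x n \<noteq> y n)"
    by (rule LeastI_ex) (use False in blast)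
  then have "m \<le> (LEAST n. x n \<noteq> y n)" using assms by (meson not_less)
  then show ?thesis by (simp add: seq_dist_eq[OF False] power_decreasing)
qed simp

text \<open>Nonzero distances are powers of \<open>1/2\<close>, so the strict bound pushes the first
  disagreement beyond index \<open>m\<close>. In particular \<open>m = 0\<close> already fixes the
  first entry.\<close>

lemma seq_dist_less_agree:
  assumes "seq_dist x y < (1 / 2) ^ m" and "j \<le> m"
  shows "x j = y j"
proof (rule ccontr)
  assume ne: "x j \<noteq> y j"
  then have "(LEAST n. x n \<noteq> y n) \<le> j" by (rule Least_le)
  then have "(1 / 2 :: real) ^ m \<le> (1 / 2) ^ (LEAST n. x n \<noteq> y n)"
    using assms(2) by (intro power_decreasing) auto
  moreover have "x \<noteq> y" using ne by auto
  ultimately show False using assms(1) by (simp add: seq_dist_eq)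
qed

lemma seq_dist_shift:
  assumes "x 0 = y 0" shows "seq_dist (shift x) (shift y) = 2 * seq_dist x y"
proof (cases "x = y")
  case False
  then obtain n where "x n \<noteq> y n" by blast
  then have "(LEAST n. x n \<noteq> y n) = Suc (LEAST n. x (Suc n) \<noteq> y (Suc n))"
    by (rule Least_Suc) (use assms in simp)
  moreover have "shift x \<noteq> shift y"
    using \<open>x n \<noteq> y n\<close> assms unfolding shift_def fun_eq_iff by (metis not0_implies_Suc)
  ultimately show ?thesis using False by (simp add: seq_dist_eq shift_def)
qed simp

text \<open>If \<open>u\<close> and \<open>v\<close> differ among their first \<open>m\<close>
  entries, then \<open>u'\<close> and \<open>v'\<close> first differ at the same place and the
  distances coincide. Otherwise both distances are at most \<open>(1 / 2) ^ m\<close>.\<close>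

lemma seq_dist_near:
  assumes "\<forall>j<m. u j = u' j" "\<forall>j<m. v j = v' j"
  shows "\<bar>seq_dist u v - seq_dist u' v'\<bar> \<le> (1 / 2) ^ m"
proof (cases "\<forall>j<m. u j = v j")
  case True
  then have "\<forall>j<m. u' j = v' j" using assms by simp
  with True have "seq_dist u v \<le> (1 / 2) ^ m" "seq_dist u' v' \<le> (1 / 2) ^ m"
    by (simp_all add: seq_dist_le)
  then show ?thesis
    using seq_dist_nonneg[of u v] seq_dist_nonneg[of u' v'] by linarith
next
  case False
  \<comment> \<open>Restricting the search to indices below \<open>m\<close> makes the position
    visibly a function of the first \<open>m\<close> entries.\<close>
  have first: "(LEAST n. u n \<noteq> v n) = (LEAST n. n < m \<and> u n \<noteq> v n)" if "\<exists>n<m. u n \<noteq> v n"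
    for u v :: "nat \<Rightarrow> 'a"
  proof (rule antisym)
    from that obtain n where n: "n < m \<and> u n \<noteq> v n" by blast
    then show "(LEAST n. u n \<noteq> v n) \<le> (LEAST n. n < m \<and> u n \<noteq> v n)"
      by (metis (mono_tags, lifting) LeastI Least_le)
    have "(LEAST n. u n \<noteq> v n) < m" using n by (metis (mono_tags, lifting) Least_le le_less_trans)
    moreover have "u (LEAST n. u n \<noteq> v n) \<noteq> v (LEAST n. u n \<noteq> v n)"
      using n by (metis (mono_tags, lifting) LeastI)
    ultimately show "(LEAST n. n < m \<and> u n \<noteq> v n) \<le> (LEAST n. u n \<noteq> v n)"
      by (intro Least_le) simp
  qed
  from False have ne: "\<exists>n<m. u n \<noteq> v n" and ne': "\<exists>n<m. u' n \<noteq> v' n" using assms by auto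
  have "(\<lambda>n. n < m \<and> u n \<noteq> v n) = (\<lambda>n. n < m \<and> u' n \<noteq> v' n)" using assms by auto
  then have "(LEAST n. u n \<noteq> v n) = (LEAST n. u' n \<noteq> v' n)"
    unfolding first[OF ne] first[OF ne'] by simp
  moreover have "u \<noteq> v" "u' \<noteq> v'" using ne ne' by auto
  ultimately show ?thesis by (simp add: seq_dist_eq)
qed

lemma shift_funpow: "(shift ^^ n) x = (\<lambda>j. x (n + j))"
  by (induction n) (simp_all add: shift_def)

section \<open>Identified edges\<close>

locale xi_system =
  fixes G :: "('v, 'e) pre_digraph" and H :: "('w, 'f) pre_digraph"
    and xi :: "bool \<Rightarrow> ('w, 'f, 'v, 'e) graph_map"
  assumes fin_G: "fin_digraph G" and fin_H: "fin_digraph H"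
    and emb: "graph_embedding H G (xi j)"
    and hyp: "standing_hypotheses G H xi"
begin

abbreviation "Xi \<equiv> xi_arcs H xi"

text \<open>Injectivity of each embedding and disjointness of the two ranges combined: an edge in
  \<open>Xi\<close> comes from a unique pair \<open>(j, y)\<close>. The descriptions in
  \<open>eps\<close> and \<open>flip\<close> rest on this.\<close>

lemma xi_inj: "on_arcs (xi j) y = on_arcs (xi k) z \<longleftrightarrow> j = k \<and> y = z"
  if "y \<in> arcs H" "z \<in> arcs H"
proof -
  have disj: "on_arcs (xi j) y \<noteq> on_arcs (xi (\<not> j)) z" for j
    using hyp that by (cases j) (auto simp: standing_hypotheses_def)
  have "j = k" if "on_arcs (xi j) y = on_arcs (xi k) z"
    using that disj[of True] disj[of False] by (cases j; cases k) auto
  then show ?thesis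
    using emb[of j] that unfolding graph_embedding_def by (auto dest: inj_onD)
qed

lemma xi_in_Xi [simp]: "y \<in> arcs H \<Longrightarrow> on_arcs (xi j) y \<in> Xi"
  by (cases j) (auto simp: xi_arcs_def)

lemma XiE:
  assumes "e \<in> Xi"
  obtains j y where "y \<in> arcs H" "e = on_arcs (xi j) y"
  using assms by (auto simp: xi_arcs_def)

lemma eps_xi [simp]: "eps H xi (on_arcs (xi j) y) = j" if "y \<in> arcs H"
  unfolding eps_def using that by (intro the_equality) (auto simp: xi_inj)

lemma tail_xi: "tail G (on_arcs (xi j) y) = on_verts (xi k) (tail H y)"
  and head_xi: "head G (on_arcs (xi j) y) = on_verts (xi k) (head H y)" if "y \<in> arcs H"
proof -
  have "on_verts (xi j) v = on_verts (xi k) v" if "v \<in> verts H" for v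
    using hyp that by (cases j; cases k) (auto simp: standing_hypotheses_def)
  moreover have "tail H y \<in> verts H" "head H y \<in> verts H"
    using fin_H that by (auto simp: fin_digraph_def wf_digraph_def)
  ultimately show "tail G (on_arcs (xi j) y) = on_verts (xi k) (tail H y)"
    "head G (on_arcs (xi j) y) = on_verts (xi k) (head H y)"
    using emb[of j] that by (auto simp: graph_embedding_def)
qed

text \<open>The involution of \<open>Xi\<close> exchanging the two copies of an edge of
  \<open>H\<close>; unspecified outside \<open>Xi\<close>.\<close>

definition flip :: "'e \<Rightarrow> 'e" where
  "flip e = (THE e'. \<exists>j. \<exists>y\<in>arcs H. e = on_arcs (xi j) y \<and> e' = on_arcs (xi (\<not> j)) y)"

lemma flip_xi [simp]: "flip (on_arcs (xi j) y) = on_arcs (xi (\<not> j)) y" if "y \<in> arcs H"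
  unfolding flip_def using that by (intro the_equality) (auto simp: xi_inj)

lemma flip_in_Xi [simp]: "e \<in> Xi \<Longrightarrow> flip e \<in> Xi"
  and flip_flip [simp]: "e \<in> Xi \<Longrightarrow> flip (flip e) = e"
  and eps_flip [simp]: "e \<in> Xi \<Longrightarrow> eps H xi (flip e) = (\<not> eps H xi e)"
  by (auto elim!: XiE)

lemma tau_eq_iff:
  assumes "e \<in> arcs G" "e' \<in> arcs G"
  shows "tau G H xi e = tau G H xi e' \<longleftrightarrow> e = e' \<or> e \<in> Xi \<and> e' = flip e"
proof -
  have "tau G H xi e = tau G H xi e' \<longleftrightarrow> (e, e') \<in> arc_ident G H xi"
    unfolding tau_def using assms equiv_arc_ident[OF emb hyp]
    by (simp add: eq_equiv_class_iff)
  also have "\<dots> \<longleftrightarrow> e = e' \<or> e \<in> Xi \<and> e' = flip e"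
    using assms by (auto simp: arc_ident_def xi_inj elim!: XiE)
  finally show ?thesis .
qed

section \<open>The equivalence relation\<close>

text \<open>
  Two distinct sequences are equivalent iff they are exchanged by flipping all entries from
  some position \<open>p\<close> on, subject to a condition on the first sequence.
\<close>
definition flippable :: "nat \<Rightarrow> (nat \<Rightarrow> 'e) \<Rightarrow> bool" where
  "flippable p x \<longleftrightarrow> (\<forall>k\<ge>p. x k \<in> Xi) \<and>
     (\<exists>j. (\<forall>k>p. eps H xi (x k) = j) \<and> (eps H xi (x p) = j \<longrightarrow> p = 0 \<or> x (p - 1) \<notin> Xi))"

definition flip_from :: "nat \<Rightarrow> (nat \<Rightarrow> 'e) \<Rightarrow> nat \<Rightarrow> 'e" where
  "flip_from p x = (\<lambda>k. if k < p then x k else flip (x k))"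

lemma flippableE:
  assumes "flippable p x"
  obtains j where "\<And>k. k > p \<Longrightarrow> eps H xi (x k) = j"
    "eps H xi (x p) = j \<Longrightarrow> p = 0 \<or> x (p - 1) \<notin> Xi" "\<And>k. k \<ge> p \<Longrightarrow> x k \<in> Xi"
  using assms unfolding flippable_def
proof (elim conjE exE)
  fix j assume "\<forall>k\<ge>p. x k \<in> Xi" "\<forall>k>p. eps H xi (x k) = j"
    "eps H xi (x p) = j \<longrightarrow> p = 0 \<or> x (p - 1) \<notin> Xi"
  then show thesis by (intro that[of j]) simp_all
qed

lemma flippableI:
  assumes "\<And>k. k > p \<Longrightarrow> eps H xi (x k) = j"
    "eps H xi (x p) = j \<Longrightarrow> p = 0 \<or> x (p - 1) \<notin> Xi" "\<And>k. k \<ge> p \<Longrightarrow> x k \<in> Xi"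
  shows "flippable p x"
  unfolding flippable_def using assms by (intro conjI exI[of _ j]) simp_all

lemma flippable_Xi: "flippable p x \<Longrightarrow> p \<le> k \<Longrightarrow> x k \<in> Xi"
  by (simp add: flippable_def)

text \<open>Past \<open>p\<close> all digits are equal, so a later position \<open>q\<close> would
  need a free edge just before it; but that entry already lies in \<open>Xi\<close>. Consequently a
  class has at most two elements.\<close>

lemma flippable_unique:
  assumes "flippable p x" "flippable q x" shows "p = q"
proof -
  have False if p: "flippable p x" and q: "flippable q x" and "p < q" for p q
  proof -
    from p obtain i where i: "\<And>k. k > p \<Longrightarrow> eps H xi (x k) = i"
      by (rule flippableE) (rule that)
    from q obtain j where j: "\<And>k. k > q \<Longrightarrow> eps H xi (x k) = j"
      "eps H xi (x q) = j \<Longrightarrow> q = 0 \<or> x (q - 1) \<notin> Xi"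
      by (rule flippableE) (rule that)
    have "eps H xi (x q) = j"
      using i[of q] i[of "Suc q"] j(1)[of "Suc q"] \<open>p < q\<close> by simp
    then have "x (q - 1) \<notin> Xi" using j(2) \<open>p < q\<close> by simp
    moreover have "p \<le> q - 1" using \<open>p < q\<close> by simp
    ultimately show False using p by (simp add: flippable_def)
  qed
  from this[of p q] this[of q p] show ?thesis using assms by (metis linorder_neqE_nat)
qed

lemma flip_from_simps [simp]:
  "k < p \<Longrightarrow> flip_from p x k = x k" "p \<le> k \<Longrightarrow> flip_from p x k = flip (x k)"
  by (simp_all add: flip_from_def)

text \<open>Flipping complements the digits from \<open>p\<close> on and keeps the earlier entries,
  so the condition persists with \<open>\<not> j\<close> in place of \<open>j\<close>.\<close>

lemma flippable_flip_from:
  assumes "flippable p x" shows "flippable p (flip_from p x)"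
proof -
  from assms obtain j where j: "\<And>k. k > p \<Longrightarrow> eps H xi (x k) = j"
    "eps H xi (x p) = j \<Longrightarrow> p = 0 \<or> x (p - 1) \<notin> Xi" and Xi: "\<And>k. k \<ge> p \<Longrightarrow> x k \<in> Xi"
    by (rule flippableE) (rule that)
  show ?thesis
  proof (rule flippableI)
    show "eps H xi (flip_from p x k) = (\<not> j)" if "k > p" for k
      using j(1)[OF that] Xi[of k] that by simp
    show "p = 0 \<or> flip_from p x (p - 1) \<notin> Xi" if "eps H xi (flip_from p x p) = (\<not> j)"
      using j(2) Xi[of p] that by (cases "p = 0") simp_all
    show "flip_from p x k \<in> Xi" if "k \<ge> p" for k using Xi that by simp
  qed
qed

lemma flip_from_flip_from: "flip_from p (flip_from p x) = x" if "flippable p x"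
  using that by (simp add: flippable_Xi flip_from_def fun_eq_iff)

text \<open>Here the digit at \<open>m\<close> differs from all later ones, as in the two binary
  expansions of a dyadic number, so the condition on the preceding edge is vacuous.\<close>

lemma xi_step1_flip:
  assumes "xi_step1 H xi x x'" shows "\<exists>p. flippable p x \<and> x' = flip_from p x"
  using assms unfolding xi_step1_def
proof (elim exE conjE)
  fix m j y
  assume y: "\<forall>k\<ge>m. y k \<in> arcs H" and eq: "\<forall>k<m. x k = x' k"
    and m: "x m = on_arcs (xi (\<not> j)) (y m)" "x' m = on_arcs (xi j) (y m)"
    and after: "\<forall>k>m. x k = on_arcs (xi j) (y k) \<and> x' k = on_arcs (xi (\<not> j)) (y k)"
  have *: "x k \<in> Xi \<and> eps H xi (x k) = (if k = m then \<not> j else j) \<and> x' k = flip (x k)"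
    if "k \<ge> m" for k
  proof (cases "k = m")
    case True
    with y m show ?thesis by simp
  next
    case False
    with y after that show ?thesis by simp
  qed
  have "flippable m x"
    by (rule flippableI[of _ _ j]) (simp_all add: *)
  moreover have "x' = flip_from m x"
    using eq * by (simp add: flip_from_def fun_eq_iff)
  ultimately show ?thesis by blast
qed

text \<open>Here all digits from \<open>m\<close> on agree: all 0 or all 1, that is, angle 0 or one
  full turn. This identification is allowed only where a block begins.\<close>

lemma xi_step2_flip:
  assumes "xi_step2 H xi x x'" shows "\<exists>p. flippable p x \<and> x' = flip_from p x"
  using assms unfolding xi_step2_def
proof (elim exE conjE)
  fix m j y
  assume y: "\<forall>k\<ge>m. y k \<in> arcs H" and free: "m = 0 \<or> x (m - 1) \<notin> Xi"
    and eq: "\<forall>k<m. x k = x' k"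
    and after: "\<forall>k\<ge>m. x k = on_arcs (xi j) (y k) \<and> x' k = on_arcs (xi (\<not> j)) (y k)"
  have *: "x k \<in> Xi \<and> eps H xi (x k) = j \<and> x' k = flip (x k)" if "k \<ge> m" for k
    using y after that by simp
  have "flippable m x"
    by (rule flippableI[of _ _ j]) (use free in \<open>simp_all add: *\<close>)
  moreover have "x' = flip_from m x"
    using eq * by (simp add: flip_from_def fun_eq_iff)
  ultimately show ?thesis by blast
qed

lemma xi_step_flip_from:
  assumes p: "flippable p x"
  shows "xi_step1 H xi x (flip_from p x) \<or> xi_step2 H xi x (flip_from p x)"
proof -
  from p obtain j where j: "\<And>k. k > p \<Longrightarrow> eps H xi (x k) = j"
    "eps H xi (x p) = j \<Longrightarrow> p = 0 \<or> x (p - 1) \<notin> Xi"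
    by (rule flippableE) (rule that)
  have "\<forall>k\<ge>p. \<exists>z. z \<in> arcs H \<and> x k = on_arcs (xi (eps H xi (x k))) z"
  proof (intro allI impI)
    fix k assume "k \<ge> p"
    then have "x k \<in> Xi" using flippable_Xi[OF p] by blast
    then show "\<exists>z. z \<in> arcs H \<and> x k = on_arcs (xi (eps H xi (x k))) z" by (auto elim!: XiE)
  qed
  then obtain y where y: "\<And>k. k \<ge> p \<Longrightarrow> y k \<in> arcs H"
    "\<And>k. k \<ge> p \<Longrightarrow> x k = on_arcs (xi (eps H xi (x k))) (y k)"
    by metis
  have flip: "flip (x k) = on_arcs (xi (\<not> eps H xi (x k))) (y k)" if "k \<ge> p" for k
    using flip_xi[OF y(1)[OF that], of "eps H xi (x k)"] y(2)[OF that] by simp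
  have after: "x k = on_arcs (xi j) (y k)" "flip (x k) = on_arcs (xi (\<not> j)) (y k)"
    if "k > p" for k
    using y(2)[of k] flip[of k] j(1)[OF that] that by simp_all
  show ?thesis
  \<comment> \<open>The digit at \<open>p\<close> decides between the two clauses: equal to the
    later digits gives (2), different gives (1).\<close>
  proof (cases "eps H xi (x p) = j")
    case True
    then have "x k = on_arcs (xi j) (y k) \<and> flip (x k) = on_arcs (xi (\<not> j)) (y k)"
      if "k \<ge> p" for k
      using y(2)[of k] flip[of k] j(1)[of k] that by (cases "k = p") simp_all
    then have "xi_step2 H xi x (flip_from p x)"
      unfolding xi_step2_def using y(1) j(2)[OF True]
      by (intro exI[of _ p] exI[of _ j] exI[of _ y]) simp
    then show ?thesis ..
  next
    case False
    then have "eps H xi (x p) = (\<not> j)" by simp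
    then have "x p = on_arcs (xi (\<not> j)) (y p)" "flip (x p) = on_arcs (xi j) (y p)"
      using y(2)[of p] flip[of p] by simp_all
    then have "xi_step1 H xi x (flip_from p x)"
      unfolding xi_step1_def using y(1) after
      by (intro exI[of _ p] exI[of _ j] exI[of _ y]) simp
    then show ?thesis ..
  qed
qed

lemma xi_rel_iff:
  "(x, x') \<in> xi_rel G H xi \<longleftrightarrow> x \<in> path_space G \<and> x' \<in> path_space G
     \<and> (x = x' \<or> (\<exists>p. flippable p x \<and> x' = flip_from p x))"
  unfolding xi_rel_def using xi_step1_flip xi_step2_flip xi_step_flip_from by blast

text \<open>Flipping twice at the same position is the identity, which gives symmetry. Since the
  position is unique, two successive flips lead back to the start, which gives transitivity.\<close>

lemma equiv_xi_rel: "equiv (path_space G) (xi_rel G H xi)"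
proof (rule equivI)
  show "xi_rel G H xi \<subseteq> path_space G \<times> path_space G" by (auto simp: xi_rel_iff)
  show "refl_on (path_space G) (xi_rel G H xi)" by (auto simp: refl_on_def xi_rel_iff)
  show "sym (xi_rel G H xi)"
    by (rule symI) (metis xi_rel_iff flippable_flip_from flip_from_flip_from)
  show "trans (xi_rel G H xi)"
    by (rule transI) (metis xi_rel_iff flippable_flip_from flip_from_flip_from flippable_unique)
qed

lemma xi_rel_refl: "x \<in> path_space G \<Longrightarrow> (x, x) \<in> xi_rel G H xi"
  by (simp add: xi_rel_iff)

lemma shift_in_path_space: "x \<in> path_space G \<Longrightarrow> shift x \<in> path_space G"
  by (simp add: path_space_def shift_def)

text \<open>A flip from \<open>p\<close> on becomes a flip from \<open>p - 1\<close> on. Truncated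
  subtraction also covers \<open>p = 0\<close>, where the whole shifted sequence is flipped.\<close>

lemma xi_rel_shift:
  assumes "(x, x') \<in> xi_rel G H xi" shows "(shift x, shift x') \<in> xi_rel G H xi"
proof -
  have "flippable (p - 1) (shift x) \<and> shift (flip_from p x) = flip_from (p - 1) (shift x)"
    if "flippable p x" for p
  proof
    from that obtain j where j: "\<And>k. k > p \<Longrightarrow> eps H xi (x k) = j"
      "eps H xi (x p) = j \<Longrightarrow> p = 0 \<or> x (p - 1) \<notin> Xi" and Xi: "\<And>k. k \<ge> p \<Longrightarrow> x k \<in> Xi"
      by (rule flippableE) (rule that)
    show "flippable (p - 1) (shift x)"
      by (rule flippableI[of _ _ j]) (use j Xi in \<open>cases p; auto simp: shift_def\<close>)+
    show "shift (flip_from p x) = flip_from (p - 1) (shift x)"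
      by (cases p) (simp_all add: shift_def flip_from_def fun_eq_iff)
  qed
  then show ?thesis using assms by (auto simp: xi_rel_iff shift_in_path_space)
qed

lemma xi_rel_shift_funpow:
  "(x, x') \<in> xi_rel G H xi \<Longrightarrow> ((shift ^^ n) x, (shift ^^ n) x') \<in> xi_rel G H xi"
  by (induction n) (auto intro: xi_rel_shift)

lemma xi_rel_tau:
  assumes "(x, x') \<in> xi_rel G H xi" shows "tau G H xi (x n) = tau G H xi (x' n)"
proof -
  have "x n \<in> arcs G" "x' n \<in> arcs G"
    using assms by (auto simp: xi_rel_iff path_space_def)
  moreover have "x n = x' n \<or> x n \<in> Xi \<and> x' n = flip (x n)"
    using assms by (auto simp: xi_rel_iff flip_from_def not_less split: if_splits intro: flippable_Xi)
  ultimately show ?thesis by (simp add: tau_eq_iff)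
qed

section \<open>The shift on the quotient\<close>

lemma xi_proj_eq: "(x, x') \<in> xi_rel G H xi \<Longrightarrow> xi_proj G H xi x = xi_proj G H xi x'"
  unfolding xi_proj_def by (rule equiv_class_eq[OF equiv_xi_rel])

lemma xi_shift_proj:
  assumes "x \<in> path_space G"
  shows "xi_shift G H xi (xi_proj G H xi x) = xi_proj G H xi (shift x)"
proof -
  have "{xi_proj G H xi (shift x') | x'. x' \<in> xi_proj G H xi x} = {xi_proj G H xi (shift x)}"
    using assms xi_proj_eq[OF xi_rel_shift]
    by (auto simp: xi_proj_def[of G H xi x] xi_rel_iff[of x x] intro!: exI[of _ x])
  then show ?thesis by (simp add: xi_shift_def)
qed

section \<open>Blocks of identified edges\<close>

lemma kappa_shift:
  "kappa H xi x = (if x 0 \<in> Xi then kappa H xi (shift x) else eSuc (kappa H xi (shift x)))"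
proof -
  let ?S = "{n. x n \<notin> Xi}" and ?T = "{n. shift x n \<notin> Xi}"
  have S: "?S = (if x 0 \<in> Xi then {} else {0}) \<union> Suc ` ?T"
  proof (rule set_eqI)
    show "n \<in> ?S \<longleftrightarrow> n \<in> (if x 0 \<in> Xi then {} else {0}) \<union> Suc ` ?T" for n
      by (cases n) (auto simp: shift_def)
  qed
  have "finite ?S \<longleftrightarrow> finite ?T" by (simp add: S finite_image_iff)
  moreover have "card ?S = (if x 0 \<in> Xi then 0 else 1) + card ?T" if "finite ?T"
    unfolding S using that by (subst card_Un_disjoint) (auto simp: card_image)
  ultimately show ?thesis by (auto simp: kappa_def Let_def eSuc_enat)
qed

lemma kappa_eq_0_iff: "kappa H xi x = 0 \<longleftrightarrow> (\<forall>n. x n \<in> Xi)"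
  by (auto simp: kappa_def Let_def zero_enat_def dest: not_finite_existsD)

text \<open>Position of the first free edge counted from 0, so that \<open>first_free\<close> is
  \<open>Suc p\<close>. Being a relation, it has no default value when every edge lies in
  \<open>Xi\<close>.\<close>

definition first_at :: "nat \<Rightarrow> (nat \<Rightarrow> 'e) \<Rightarrow> bool" where
  "first_at p x \<longleftrightarrow> x p \<notin> Xi \<and> (\<forall>j<p. x j \<in> Xi)"

definition psum :: "(nat \<Rightarrow> 'e) \<Rightarrow> nat \<Rightarrow> real" where
  "psum x m = (\<Sum>j<m. of_bool (eps H xi (x j)) / 2 ^ Suc j)"

text \<open>A real argument of \<open>theta H xi x\<close>, counted in full turns.\<close>

definition angle :: "(nat \<Rightarrow> 'e) \<Rightarrow> real" where
  "angle x = (if kappa H xi x = 0 then (\<Sum>j. of_bool (eps H xi (x j)) / 2 ^ Suc j)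
     else psum x (first_free H xi x - 1))"

lemma first_at_unique: "first_at p x \<Longrightarrow> first_at q x \<Longrightarrow> p = q"
  unfolding first_at_def by (metis linorder_neqE_nat)

lemma first_atI:
  assumes "x n \<notin> Xi" obtains p where "p \<le> n" "first_at p x"
proof (rule that)
  show "(LEAST n. x n \<notin> Xi) \<le> n" using assms by (rule Least_le)
  show "first_at (LEAST n. x n \<notin> Xi) x"
    using LeastI[of "\<lambda>n. x n \<notin> Xi", OF assms] not_less_Least by (auto simp: first_at_def)
qed

lemma first_free_eq: "first_at p x \<Longrightarrow> first_free H xi x = Suc p"
  unfolding first_free_def first_at_def by (auto intro: Least_equality leI)

lemma angle_eq: "first_at p x \<Longrightarrow> angle x = psum x p"
  by (auto simp: angle_def first_free_eq kappa_eq_0_iff first_at_def)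

lemma kappa_first_at: "kappa H xi x = eSuc (kappa H xi ((shift ^^ Suc p) x))" if "first_at p x"
  using that
proof (induction p arbitrary: x)
  case 0
  then show ?case by (simp add: first_at_def kappa_shift[of x])
next
  case (Suc p)
  then have "first_at p (shift x)" "x 0 \<in> Xi" by (auto simp: first_at_def shift_def)
  then show ?case
    using Suc.IH[of "shift x"] by (simp add: kappa_shift[of x] funpow_Suc_right del: funpow.simps)
qed

text \<open>What one unfolding of \<open>lam\<close> requires. Only a lower bound on
  \<open>kappa\<close> is carried along, so sequences with infinitely many free edges are covered
  too.\<close>

lemma kappa_SucE:
  assumes "enat (Suc k) \<le> kappa H xi x"
  obtains p where "first_at p x" "enat k \<le> kappa H xi ((shift ^^ Suc p) x)"
proof -
  have "kappa H xi x \<noteq> 0" using assms by (auto simp: zero_enat_def)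
  then obtain p where p: "first_at p x" using first_atI unfolding kappa_eq_0_iff by metis
  with assms have "enat k \<le> kappa H xi ((shift ^^ Suc p) x)"
    by (simp add: kappa_first_at[OF p] eSuc_enat[symmetric] del: funpow.simps)
  with p show thesis by (rule that)
qed

lemma circ_dist_theta:
  "circ_dist (theta H xi x) (theta H xi y) = turn_dist (angle y - angle x)"
proof -
  have "theta H xi x = exp (2 * of_real pi * \<i> * of_real (angle x))" for x
    by (simp add: theta_def angle_def psum_def)
  then show ?thesis by (simp only: circ_dist_exp)
qed

lemma theta_eq_iff: "theta H xi x = theta H xi y \<longleftrightarrow> turn_dist (angle y - angle x) = 0"
proof -
  have "theta H xi x = exp (2 * of_real pi * \<i> * of_real (angle x))" for x
    by (simp add: theta_def angle_def psum_def)
  then show ?thesis by (simp only: exp_turn_eq_iff_turn_dist)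
qed

section \<open>The recursion for \<open>lam\<close> and its bounds\<close>

lemma lam_0: "lam H xi 0 x y = turn_dist (angle y - angle x)"
  by (simp add: circ_dist_theta)

text \<open>The exponent \<open>p + 3\<close> is \<open>2 + first_free H xi x\<close>, and equality
  of the two \<open>theta\<close> values appears as the vanishing of
  \<open>turn_dist\<close>.\<close>

lemma lam_Suc:
  assumes "first_at p x" "first_at q y"
  shows "lam H xi (Suc k) x y = \<bar>(1 / 2) ^ Suc p - (1 / 2) ^ Suc q\<bar> + turn_dist (psum y q - psum x p)
    + (if p = q \<and> turn_dist (psum y q - psum x p) = 0
       then (1 / 2) ^ (p + 3) * lam H xi k ((shift ^^ Suc p) x) ((shift ^^ Suc q) y) else 0)"
  using assms
  by (cases "p = q") (simp_all add: circ_dist_theta theta_eq_iff first_free_eq angle_eq power_add power2_eq_square power3_eq_cube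
      del: funpow.simps)

text \<open>The first two terms are at most \<open>1/2\<close> each, and the recursive one is at
  most \<open>1/8\<close> times the inductive bound 2.\<close>

lemma lam_bounds: "0 \<le> lam H xi k x y \<and> lam H xi k x y \<le> 2"
proof (induction k arbitrary: x y)
  case 0
  then show ?case using turn_dist_le_half[of "angle y - angle x"] by (simp add: lam_0 del: lam.simps)
next
  case (Suc k)
  have half: "0 \<le> (1 / 2 :: real) ^ first_free H xi z \<and> (1 / 2 :: real) ^ first_free H xi z \<le> 1 / 2" for z
    by (simp add: first_free_def power_le_one)
  define L where "L = lam H xi k ((shift ^^ first_free H xi x) x) ((shift ^^ first_free H xi y) y)"
  have L: "0 \<le> L \<and> L \<le> 2" unfolding L_def by (rule Suc.IH)
  have "(1 / 2 :: real) ^ first_free H xi x * L \<le> 1 / 2 * 2"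
    using half[of x] L by (intro mult_mono) auto
  moreover have "0 \<le> (1 / 2 :: real) ^ first_free H xi x * L" using L by simp
  moreover have "turn_dist (angle y - angle x) \<le> 1 / 2" by (rule turn_dist_le_half)
  moreover have "\<bar>(1 / 2 :: real) ^ first_free H xi x - (1 / 2) ^ first_free H xi y\<bar> \<le> 1 / 2"
    using half[of x] half[of y] by linarith
  moreover have "lam H xi (Suc k) x y =
      \<bar>(1 / 2) ^ first_free H xi x - (1 / 2) ^ first_free H xi y\<bar> + turn_dist (angle y - angle x)
      + (if first_free H xi x = first_free H xi y \<and> theta H xi x = theta H xi y
         then (1 / 2) ^ first_free H xi x * L / 4 else 0)"
    by (simp add: circ_dist_theta power_add power2_eq_square L_def)
  ultimately show ?case
    using turn_dist_nonneg[of "angle y - angle x"] by (auto split: if_splits)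
qed

lemma psum_Suc: "psum x (Suc m) = psum x m + of_bool (eps H xi (x m)) * (1 / 2) ^ Suc m"
  by (simp add: psum_def power_divide)

lemma psum_0 [simp]: "psum x 0 = 0"
  by (simp add: psum_def)

lemma psum_shift: "psum x (Suc m) = of_bool (eps H xi (x 0)) / 2 + psum (shift x) m / 2"
  unfolding psum_def by (simp only: sum.lessThan_Suc_shift) (simp add: shift_def sum_divide_distrib)

lemma psum_cong: "(\<And>j. j < m \<Longrightarrow> x j = y j) \<Longrightarrow> psum x m = psum y m"
  by (simp add: psum_def)

text \<open>The digits from \<open>p\<close> to \<open>q - 1\<close> contribute at most the
  geometric sum \<open>(1 / 2) ^ p - (1 / 2) ^ q\<close>.\<close>

lemma psum_tail:
  assumes "p \<le> q" shows "psum x p \<le> psum x q \<and> psum x q \<le> psum x p + (1 / 2) ^ p - (1 / 2) ^ q"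
  using assms
proof (induction q rule: dec_induct)
  case (step n)
  define h where "h = (1 / 2 :: real) ^ n"
  have "0 \<le> h" by (simp add: h_def)
  with step show ?case by (auto simp: psum_Suc h_def[symmetric])
qed simp

section \<open>Closeness and uniform continuity of \<open>lam\<close>\<close>

text \<open>
  \<open>close m x x'\<close> means that \<open>x\<close> and \<open>x'\<close> cannot be told apart by the metric, up to an error of
  order \<open>2\<^sup>-\<^sup>m\<close>, from their first \<open>m\<close> entries. Both agreement of these entries and
  equivalence imply it.
\<close>
inductive close :: "nat \<Rightarrow> (nat \<Rightarrow> 'e) \<Rightarrow> (nat \<Rightarrow> 'e) \<Rightarrow> bool" where
  far: "\<forall>j<m. x j \<in> Xi \<and> x' j \<in> Xi \<Longrightarrow> turn_dist (psum x' m - psum x m) \<le> (1 / 2) ^ m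
    \<Longrightarrow> close m x x'"
| free: "p < m \<Longrightarrow> first_at p x \<Longrightarrow> \<forall>j\<le>p. x j = x' j
    \<Longrightarrow> close (m - Suc p) ((shift ^^ Suc p) x) ((shift ^^ Suc p) x') \<Longrightarrow> close m x x'"

text \<open>Both rules inspect only the first \<open>m\<close> entries. Closeness of two limits
  therefore passes to sequences approximating them.\<close>

lemma close_cong:
  assumes "close m x x'" "\<forall>j<m. z j = x j" "\<forall>j<m. z' j = x' j" shows "close m z z'"
  using assms
proof (induction arbitrary: z z' rule: close.induct)
  case (far m x x')
  then have "psum z m = psum x m" "psum z' m = psum x' m" by (auto intro: psum_cong)
  with far show ?case by (intro close.far) auto
next
  case (free p m x x')
  show ?case
  proof (rule close.free[of p])
    show "first_at p z" using free.hyps free.prems by (simp add: first_at_def)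
    show "close (m - Suc p) ((shift ^^ Suc p) z) ((shift ^^ Suc p) z')"
      using free.prems by (intro free.IH) (simp_all add: shift_funpow del: funpow.simps)
  qed (use free.hyps free.prems in auto)
qed

text \<open>In the first case the constant 3 is made up of one unit for the sums up to
  \<open>m\<close> and at most one for each of the two tails beyond \<open>m\<close>.\<close>

lemma close_cases:
  assumes c: "close m x x'" and p: "first_at p x" and p': "first_at p' x'"
  obtains (far) "m \<le> p" "m \<le> p'" "turn_dist (psum x' p' - psum x p) \<le> 3 * (1 / 2) ^ m"
  | (free) "p < m" "p' = p" "psum x p = psum x' p"
    "close (m - Suc p) ((shift ^^ Suc p) x) ((shift ^^ Suc p) x')"
  using c
proof cases
  case far
  then have le: "m \<le> p" "m \<le> p'" using p p' by (auto simp: first_at_def not_less[symmetric])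
  define t where "t = (psum x' p' - psum x' m) - (psum x p - psum x m)"
  have "psum x' p' - psum x p = (psum x' m - psum x m) + t" by (simp add: t_def)
  then have "turn_dist (psum x' p' - psum x p) \<le> turn_dist (psum x' m - psum x m) + \<bar>t\<bar>"
    using turn_dist_add[of "psum x' m - psum x m" t] turn_dist_le_abs[of t] by simp
  moreover have "0 \<le> (1 / 2 :: real) ^ p" "0 \<le> (1 / 2 :: real) ^ p'" by simp_all
  ultimately have "turn_dist (psum x' p' - psum x p) \<le> 3 * (1 / 2) ^ m"
    using psum_tail[OF le(1), of x] psum_tail[OF le(2), of x'] far(2) unfolding t_def by linarith
  with le show thesis by (rule that(1))
next
  case (free q)
  then have "q = p" using p first_at_unique by blast
  moreover have "first_at q x'" using free by (simp add: first_at_def)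
  then have "q = p'" using p' first_at_unique by blast
  moreover have "psum x q = psum x' q" using free by (intro psum_cong) auto
  ultimately show thesis using free by (intro that(2)) auto
qed

text \<open>Induction on \<open>k\<close>, peeling one block off all four sequences. If both blocks
  end before \<open>m\<close>, the leading terms agree and the factor
  \<open>(1 / 2) ^ (p + 3)\<close> pays for the \<open>p + 1\<close> entries and the one level used
  up. If a block reaches \<open>m\<close>, every term changes by a multiple of
  \<open>(1 / 2) ^ m\<close>. When either recursion has run out, the trivial bound 2 equals the
  second error term.\<close>

lemma lam_near:
  assumes "enat k \<le> kappa H xi x" "enat k \<le> kappa H xi y"
    and "enat k' \<le> kappa H xi x'" "enat k' \<le> kappa H xi y'"
    and "close m x x'" "close m y y'"
  shows "\<bar>lam H xi k x y - lam H xi k' x' y'\<bar> \<le> 16 * (1 / 2) ^ m + 2 * (1 / 2) ^ min k k'"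
  using assms
proof (induction k arbitrary: k' m x y x' y')
  case 0
  have "\<bar>lam H xi 0 x y - lam H xi k' x' y'\<bar> \<le> 2"
    using lam_bounds[of 0 x y] lam_bounds[of k' x' y'] by linarith
  also have "\<dots> \<le> 16 * (1 / 2) ^ m + 2 * (1 / 2) ^ min 0 k'" by simp
  finally show ?case .
next
  case (Suc k)
  show ?case
  proof (cases k')
    case 0
    have "\<bar>lam H xi (Suc k) x y - lam H xi k' x' y'\<bar> \<le> 2"
      using lam_bounds[of "Suc k" x y] lam_bounds[of k' x' y'] by linarith
    also have "\<dots> \<le> 16 * (1 / 2) ^ m + 2 * (1 / 2) ^ min (Suc k) k'" by (simp add: 0)
    finally show ?thesis .
  next
    case (Suc i)
    obtain p where p: "first_at p x" and kp: "enat k \<le> kappa H xi ((shift ^^ Suc p) x)"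
      using Suc.prems(1) by (rule kappa_SucE)
    obtain q where q: "first_at q y" and kq: "enat k \<le> kappa H xi ((shift ^^ Suc q) y)"
      using Suc.prems(2) by (rule kappa_SucE)
    obtain p' where p': "first_at p' x'" and kp': "enat i \<le> kappa H xi ((shift ^^ Suc p') x')"
      using Suc.prems(3) unfolding \<open>k' = Suc i\<close> by (rule kappa_SucE)
    obtain q' where q': "first_at q' y'" and kq': "enat i \<le> kappa H xi ((shift ^^ Suc q') y')"
      using Suc.prems(4) unfolding \<open>k' = Suc i\<close> by (rule kappa_SucE)
    define R where "R = (\<lambda>k x y p q. if p = q \<and> turn_dist (psum y q - psum x p) = 0
      then (1 / 2) ^ (p + 3) * lam H xi k ((shift ^^ Suc p) x) ((shift ^^ Suc q) y) else 0)"
    have lam: "lam H xi (Suc k) x y = \<bar>(1 / 2) ^ Suc p - (1 / 2) ^ Suc q\<bar>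
        + turn_dist (psum y q - psum x p) + R k x y p q"
      "lam H xi k' x' y' = \<bar>(1 / 2) ^ Suc p' - (1 / 2) ^ Suc q'\<bar>
        + turn_dist (psum y' q' - psum x' p') + R i x' y' p' q'"
      unfolding R_def \<open>k' = Suc i\<close> using lam_Suc p q p' q' by blast+
    have near: "\<bar>(1 / 2 :: real) ^ Suc p - (1 / 2) ^ Suc p'\<bar> \<le> (1 / 2) ^ m
        \<and> turn_dist (psum x' p' - psum x p) \<le> 3 * (1 / 2) ^ m"
      if "close m x x'" "first_at p x" "first_at p' x'" for x x' p p'
      using that
    proof (cases rule: close_cases)
      case far
      then have "(1 / 2 :: real) ^ Suc p \<le> (1 / 2) ^ m" "(1 / 2 :: real) ^ Suc p' \<le> (1 / 2) ^ m"
        by (intro power_decreasing; simp)+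
      moreover have "0 \<le> (1 / 2 :: real) ^ Suc p" "0 \<le> (1 / 2 :: real) ^ Suc p'" by simp_all
      ultimately have "\<bar>(1 / 2 :: real) ^ Suc p - (1 / 2) ^ Suc p'\<bar> \<le> (1 / 2) ^ m" by linarith
      with far show ?thesis by blast
    qed (simp add: turn_dist_def)
    \<comment> \<open>One of the two inequalities suffices, because the term vanishes unless
      \<open>p = q\<close>.\<close>
    have R_bound: "0 \<le> R k x y p q \<and> R k x y p q \<le> (1 / 2) ^ m" if "m \<le> p \<or> m \<le> q" for k x y p q
    proof -
      have "(1 / 2) ^ (p + 3) * lam H xi k ((shift ^^ Suc p) x) ((shift ^^ Suc q) y)
          \<le> (1 / 2) ^ Suc m * 2" if "m \<le> p"
        using that lam_bounds by (intro mult_mono power_decreasing) auto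
      then show ?thesis using that lam_bounds unfolding R_def by (auto simp del: funpow.simps)
    qed
    show ?thesis
    proof (cases "p < m \<and> q < m")
      case True
      then have eq: "p' = p" "q' = q" "psum x p = psum x' p" "psum y q = psum y' q"
        and cx: "close (m - Suc p) ((shift ^^ Suc p) x) ((shift ^^ Suc p) x')"
        and cy: "close (m - Suc q) ((shift ^^ Suc q) y) ((shift ^^ Suc q) y')"
        using close_cases[OF Suc.prems(5) p p'] close_cases[OF Suc.prems(6) q q']
        by (metis not_less)+
      have "\<bar>R k x y p q - R i x' y' p q\<bar> \<le> 16 * (1 / 2) ^ m + 2 * (1 / 2) ^ min (Suc k) (Suc i)"
      proof (cases "p = q \<and> turn_dist (psum y q - psum x p) = 0")
        case False
        then show ?thesis by (auto simp: R_def eq)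
      next
        case same: True
        let ?d = "lam H xi k ((shift ^^ Suc p) x) ((shift ^^ Suc q) y)
          - lam H xi i ((shift ^^ Suc p) x') ((shift ^^ Suc q) y')"
        have "\<bar>?d\<bar> \<le> 16 * (1 / 2) ^ (m - Suc p) + 2 * (1 / 2) ^ min k i"
          using kp kq kp' kq' cx cy same eq by (intro Suc.IH) simp_all
        then have "(1 / 2) ^ (p + 3) * \<bar>?d\<bar>
            \<le> (1 / 2) ^ (p + 3) * (16 * (1 / 2) ^ (m - Suc p) + 2 * (1 / 2) ^ min k i)"
          by (intro mult_left_mono) simp_all
        also have "\<dots> = 16 * (1 / 2) ^ (p + 3 + (m - Suc p)) + 2 * (1 / 2) ^ (p + 3 + min k i)"
          by (simp add: power_add algebra_simps)
        \<comment> \<open>As \<open>p < m\<close>, the first exponent equals \<open>m + 2\<close>;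
          the second is at least \<open>Suc (min k i)\<close>.\<close>
        also have "\<dots> \<le> 16 * (1 / 2) ^ m + 2 * (1 / 2) ^ min (Suc k) (Suc i)"
          using True by (intro add_mono mult_left_mono power_decreasing) auto
        finally have "\<bar>(1 / 2) ^ (p + 3) * ?d\<bar> \<le> 16 * (1 / 2) ^ m + 2 * (1 / 2) ^ min (Suc k) (Suc i)"
          by (simp add: abs_mult del: funpow.simps)
        moreover have "R k x y p q - R i x' y' p q = (1 / 2) ^ (p + 3) * ?d"
          unfolding R_def if_P[OF same] if_P[OF same[unfolded eq(3,4)]] right_diff_distrib ..
        ultimately show ?thesis by simp
      qed
      then show ?thesis unfolding lam unfolding eq \<open>k' = Suc i\<close> by simp
    next
      case False
      then have "m \<le> p \<or> m \<le> q" by auto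
      moreover from this have "m \<le> p' \<or> m \<le> q'"
        using close_cases[OF Suc.prems(5) p p'] close_cases[OF Suc.prems(6) q q']
        by (metis not_less)
      ultimately have R: "0 \<le> R k x y p q \<and> R k x y p q \<le> (1 / 2) ^ m"
        "0 \<le> R i x' y' p' q' \<and> R i x' y' p' q' \<le> (1 / 2) ^ m"
        using R_bound by blast+
      define s t where "s = psum x' p' - psum x p" and "t = psum y' q' - psum y q"
      have st: "turn_dist s \<le> 3 * (1 / 2) ^ m" "turn_dist t \<le> 3 * (1 / 2) ^ m"
        using near[OF Suc.prems(5) p p'] near[OF Suc.prems(6) q q'] by (simp_all add: s_def t_def)
      have "turn_dist (psum y q - psum x p) \<le> turn_dist (psum y' q' - psum x' p') + turn_dist (s - t)"
        "turn_dist (psum y' q' - psum x' p') \<le> turn_dist (psum y q - psum x p) + turn_dist (t - s)"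
        using turn_dist_add[of "psum y' q' - psum x' p'" "s - t"]
          turn_dist_add[of "psum y q - psum x p" "t - s"] by (simp_all add: s_def t_def)
      moreover have "turn_dist (s - t) \<le> turn_dist s + turn_dist t"
        "turn_dist (t - s) \<le> turn_dist s + turn_dist t"
        using turn_dist_add[of s "- t"] turn_dist_add[of t "- s"] by (simp_all add: turn_dist_minus)
      ultimately have "\<bar>turn_dist (psum y q - psum x p) - turn_dist (psum y' q' - psum x' p')\<bar>
          \<le> 6 * (1 / 2) ^ m"
        using st by linarith
      moreover have "\<bar>\<bar>a - b\<bar> - \<bar>a' - b'\<bar>\<bar> \<le> \<bar>a - a'\<bar> + \<bar>b - b'\<bar>" for a b a' b' :: real by linarith
      from this[of "(1 / 2) ^ Suc p" "(1 / 2) ^ Suc q" "(1 / 2) ^ Suc p'" "(1 / 2) ^ Suc q'"]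
      have "\<bar>\<bar>(1 / 2 :: real) ^ Suc p - (1 / 2) ^ Suc q\<bar> - \<bar>(1 / 2) ^ Suc p' - (1 / 2) ^ Suc q'\<bar>\<bar>
          \<le> 2 * (1 / 2) ^ m"
        using near[OF Suc.prems(5) p p'] near[OF Suc.prems(6) q q'] by linarith
      \<comment> \<open>Six units come from the angles, two from the block lengths and one from the
        recursive terms.\<close>
      ultimately have "\<bar>lam H xi (Suc k) x y - lam H xi k' x' y'\<bar> \<le> 9 * (1 / 2) ^ m"
        unfolding lam using R by linarith
      also have "\<dots> \<le> 16 * (1 / 2) ^ m + 2 * (1 / 2) ^ min (Suc k) k'" by simp
      finally show ?thesis .
    qed
  qed
qed

text \<open>Complementing \<open>m\<close> equal digits moves the sum to within
  \<open>(1 / 2) ^ m\<close> of a full turn.\<close>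

lemma flip_from_psum_const:
  assumes "\<And>k. x k \<in> Xi" "\<And>k. eps H xi (x k) = j"
  shows "psum (flip_from 0 x) m - psum x m = (if j then - 1 else 1) * (1 - (1 / 2) ^ m)"
  using assms by (induction m) (auto simp: psum_Suc)

text \<open>The change at \<open>q\<close> is opposite to all later ones, and the geometric sum
  leaves exactly one unit of the last place.\<close>

lemma flip_from_psum_alternating:
  assumes "q < m" "\<And>k. q \<le> k \<Longrightarrow> x k \<in> Xi" "eps H xi (x q) = (\<not> j)"
    "\<And>k. q < k \<Longrightarrow> eps H xi (x k) = j"
  shows "psum (flip_from q x) m - psum x m = (if j then 1 else - 1) * (1 / 2) ^ m"
proof -
  have "Suc q \<le> m" using assms by simp
  then show ?thesis
  proof (induction m rule: dec_induct)
    case base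
    have "psum (flip_from q x) q = psum x q" by (rule psum_cong) simp
    then show ?case using assms by (cases j) (simp_all add: psum_Suc)
  next
    case (step m)
    then show ?case using assms by (cases j) (simp_all add: psum_Suc)
  qed
qed

text \<open>If there is a free edge before \<open>m\<close>, the flip starts after it, so the first
  blocks agree and the induction hypothesis applies to the remainders. Otherwise only the partial
  sums up to \<open>m\<close> matter, and the two preceding computations compare them.\<close>

lemma xi_rel_close: "(x, x') \<in> xi_rel G H xi \<Longrightarrow> close m x x'"
proof (induction m arbitrary: x x' rule: less_induct)
  case (less m)
  consider "x' = x" | q where "flippable q x" "x' = flip_from q x"
    using less.prems by (auto simp: xi_rel_iff)
  note cases = this
  show ?case
  proof (cases "\<exists>n<m. x n \<notin> Xi")
    case True
    then obtain p where p: "p < m" "first_at p x" by (meson first_atI le_less_trans)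
    have "\<forall>j\<le>p. x j = x' j"
      using cases
    proof cases
      case (2 q)
      then have "p < q" using p flippable_Xi by (auto simp: first_at_def not_less[symmetric])
      with 2 show ?thesis by simp
    qed simp
    moreover have "close (m - Suc p) ((shift ^^ Suc p) x) ((shift ^^ Suc p) x')"
      using p by (intro less.IH xi_rel_shift_funpow less.prems) simp
    ultimately show ?thesis using p close.free by blast
  next
    case False
    then have Xi: "\<forall>j<m. x j \<in> Xi" by blast
    have "\<forall>j<m. x' j \<in> Xi \<and> x j \<in> Xi"
      using cases Xi by cases (simp_all add: flip_from_def)
    moreover have "turn_dist (psum x' m - psum x m) \<le> (1 / 2) ^ m"
      using cases
    proof cases
      case 1
      then show ?thesis by (simp add: turn_dist_def)
    next
      case (2 q)
      obtain j where j: "\<And>k. k > q \<Longrightarrow> eps H xi (x k) = j"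
        "eps H xi (x q) = j \<Longrightarrow> q = 0 \<or> x (q - 1) \<notin> Xi" and Xi_q: "\<And>k. k \<ge> q \<Longrightarrow> x k \<in> Xi"
        using 2(1) by (rule flippableE) (rule that)
      show ?thesis
      proof (cases "q < m")
        case False
        then have "psum x' m = psum x m" using 2 by (intro psum_cong) simp
        then show ?thesis by (simp add: turn_dist_def)
      next
        case True
        show ?thesis
        proof (cases "eps H xi (x q) = j")
          case same: True
          \<comment> \<open>A constant tail may be flipped only from the start or right after a free
            edge, and there is no free edge before \<open>m\<close>.\<close>
          have "q = 0"
          proof (rule ccontr)
            assume "q \<noteq> 0"
            then have "x (q - 1) \<notin> Xi" using j(2)[OF same] by simp
            then show False using Xi True by simp
          qed
          have "eps H xi (x k) = j" for k using j(1)[of k] same \<open>q = 0\<close> by (cases "k = 0") simp_all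
          then have "psum x' m - psum x m = (if j then - 1 else 1) * (1 - (1 / 2) ^ m)"
            unfolding 2 \<open>q = 0\<close> using Xi_q \<open>q = 0\<close> by (intro flip_from_psum_const) simp_all
          \<comment> \<open>Subtracting one full turn, with the sign given by \<open>j\<close>,
            leaves \<open>(1 / 2) ^ m\<close>.\<close>
          then show ?thesis
            using turn_dist_le[of "psum x' m - psum x m" "if j then - 1 else 1"] by (cases j) simp_all
        next
          case False
          then have "eps H xi (x q) = (\<not> j)" by simp
          then have "psum x' m - psum x m = (if j then 1 else - 1) * (1 / 2) ^ m"
            unfolding 2 using True Xi_q j(1) by (intro flip_from_psum_alternating)
          then show ?thesis
            using turn_dist_le_abs[of "psum x' m - psum x m"] by (cases j) simp_all
        qed
      qed
    qed
    ultimately show ?thesis by (intro close.far) auto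
  qed
qed

section \<open>Approximation by paths of finite level\<close>

text \<open>The hypothesis speaks of the copy under \<open>xi False\<close>; the other copy has the
  same end points because the embeddings agree on vertices.\<close>

lemma free_arc_exists:
  assumes "e \<in> arcs G"
  shows "\<exists>e'. e' \<in> arcs G \<and> e' \<notin> Xi \<and> tail G e' = tail G e \<and> head G e' = head G e"
proof (cases "e \<in> Xi")
  case True
  then obtain j y where y: "y \<in> arcs H" and e: "e = on_arcs (xi j) y" by (rule XiE)
  have "tail G e = tail G (on_arcs (xi False) y)" "head G e = head G (on_arcs (xi False) y)"
    unfolding e using tail_xi[OF y] head_xi[OF y] by metis+
  moreover have "\<exists>x\<in>arcs G - Xi. tail G x = tail G (on_arcs (xi False) y)
      \<and> head G x = head G (on_arcs (xi False) y)"
    using hyp y by (simp add: standing_hypotheses_def)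
  ultimately show ?thesis by auto
qed (use assms in blast)

definition free_arc :: "'e \<Rightarrow> 'e" where
  "free_arc e = (SOME e'. e' \<in> arcs G \<and> e' \<notin> Xi \<and> tail G e' = tail G e \<and> head G e' = head G e)"

lemma free_arc: "e \<in> arcs G \<Longrightarrow> free_arc e \<in> arcs G \<and> free_arc e \<notin> Xi
    \<and> tail G (free_arc e) = tail G e \<and> head G (free_arc e) = head G e"
  unfolding free_arc_def by (rule someI_ex) (rule free_arc_exists)

text \<open>Edges are exchanged for parallel free ones, so the vertices visited stay the same. This
  adjusts \<open>kappa\<close> without leaving the path space.\<close>

definition free_between :: "nat \<Rightarrow> nat \<Rightarrow> (nat \<Rightarrow> 'e) \<Rightarrow> nat \<Rightarrow> 'e" where
  "free_between a b x = (\<lambda>j. if a \<le> j \<and> j < b then free_arc (x j) else x j)"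

lemma free_between_level:
  assumes x: "x \<in> path_space G" and tail: "\<And>j. b \<le> j \<Longrightarrow> x j \<in> Xi" and "a \<le> b"
  shows "free_between a b x \<in> level G H xi (card {j. j < a \<and> x j \<notin> Xi} + (b - a))"
proof -
  have path: "free_between a b x \<in> path_space G"
    using x free_arc by (auto simp: free_between_def path_space_def)
  have mem: "free_between a b x j \<notin> Xi \<longleftrightarrow> (j < a \<and> x j \<notin> Xi) \<or> (a \<le> j \<and> j < b)" for j
  proof -
    have "x j \<in> arcs G" using x by (simp add: path_space_def)
    then have "free_arc (x j) \<notin> Xi" using free_arc by blast
    then show ?thesis using tail[of j] \<open>a \<le> b\<close> by (cases "j < b") (simp_all add: free_between_def not_le)
  qed
  have S: "{j. free_between a b x j \<notin> Xi} = {j. j < a \<and> x j \<notin> Xi} \<union> {a..<b}"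
    by (rule set_eqI) (simp only: mem Un_iff mem_Collect_eq atLeastLessThan_iff)
  moreover have "card ({j. j < a \<and> x j \<notin> Xi} \<union> {a..<b}) = card {j. j < a \<and> x j \<notin> Xi} + (b - a)"
    by (subst card_Un_disjoint) auto
  ultimately show ?thesis using path by (simp add: level_def kappa_def)
qed

section \<open>Concatenating paths\<close>

lemma walk_then_path:
  assumes "pre_digraph.awalk G v p w" "u \<in> path_space G" "tail G (u 0) = w"
  shows "\<exists>z\<in>path_space G. tail G (z 0) = v \<and> (\<forall>j. z (length p + j) = u j)"
  using assms(1)
proof (induction p arbitrary: v)
  case Nil
  interpret fin_digraph G by (rule fin_G)
  show ?case using Nil assms by (auto simp: awalk_def)
next
  case (Cons e p)
  interpret fin_digraph G by (rule fin_G)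
  have e: "e \<in> arcs G" "v = tail G e" and p: "awalk (head G e) p w"
    using Cons.prems by (simp_all add: awalk_Cons_iff)
  obtain z where z: "z \<in> path_space G" "tail G (z 0) = head G e" "\<forall>j. z (length p + j) = u j"
    using Cons.IH[OF p] by blast
  have "case_nat e z \<in> path_space G"
    using z e unfolding path_space_def by (auto split: nat.split)
  moreover have "\<forall>j. case_nat e z (length (e # p) + j) = u j" using z by simp
  ultimately show ?case using e by (intro bexI[of _ "case_nat e z"]) auto
qed

lemma path_join:
  assumes "x \<in> path_space G" "z \<in> path_space G" "tail G (z 0) = tail G (x N)"
  shows "(\<lambda>j. if j < N then x j else z (j - N)) \<in> path_space G"
  unfolding path_space_def
proof (intro CollectI allI conjI)
  fix n
  let ?w = "\<lambda>j. if j < N then x j else z (j - N)"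
  show "?w n \<in> arcs G" using assms by (simp add: path_space_def)
  consider "Suc n < N" | "Suc n = N" | "N \<le> n" by linarith
  then show "head G (?w n) = tail G (?w (Suc n))"
  proof cases
    case 2
    then have "\<not> Suc n < N" "n < N" "Suc n - N = 0" by simp_all
    then show ?thesis using assms 2 by (simp add: path_space_def)
  qed (use assms in \<open>simp_all add: path_space_def Suc_diff_le\<close>)
qed

text \<open>Follow \<open>x\<close>, then a connecting walk of the length \<open>k\<close> given by
  primitivity, then an infinite path inside \<open>Xi\<close>; finally free a window of edges so
  that the count is exactly \<open>l\<close>. As \<open>k\<close> is independent of
  \<open>l\<close>, the agreement with \<open>x\<close> grows with \<open>l\<close>.\<close>

lemma approximation_exists:
  assumes x: "x \<in> path_space G" and "level G H xi 0 \<noteq> {}"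
  obtains k where "\<And>l. \<exists>z\<in>level G H xi l. \<forall>j<l - k. z j = x j"
proof -
  from assms(2) obtain u where u: "u \<in> path_space G" and uXi: "\<And>j. u j \<in> Xi"
    by (auto simp: level_def zero_enat_def[symmetric] kappa_eq_0_iff)
  have "primitive_digraph G" using hyp by (simp add: standing_hypotheses_def)
  then obtain k where k: "\<forall>v\<in>verts G. \<forall>w\<in>verts G. \<exists>p. pre_digraph.awalk G v p w \<and> length p = k"
    unfolding primitive_digraph_def by (elim exE conjE)
  have vert: "tail G (z j) \<in> verts G" if "z \<in> path_space G" for z j
    using that fin_G by (simp add: path_space_def fin_digraph_def wf_digraph_def)
  have "\<exists>z\<in>level G H xi l. \<forall>j<l - k. z j = x j" for l
  proof (cases "k \<le> l")
    case False
    \<comment> \<open>For \<open>l < k\<close> no agreement is demanded, so freeing the first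
      \<open>l\<close> edges of \<open>u\<close> is enough.\<close>
    have "free_between 0 l u \<in> level G H xi (card {j. j < 0 \<and> u j \<notin> Xi} + (l - 0))"
      using u uXi by (intro free_between_level) auto
    then show ?thesis using False by auto
  next
    case True
    define a where "a = l - k"
    define c where "c = card {j. j < a \<and> x j \<notin> Xi}"
    \<comment> \<open>The window from \<open>a\<close> to \<open>N + k\<close> has length
      \<open>a - c + k\<close>; with the \<open>c\<close> free edges before \<open>a\<close> the
      total is \<open>a + k = l\<close>.\<close>
    define N where "N = a + (a - c)"
    have "c \<le> card {..<a}" unfolding c_def by (intro card_mono) auto
    then have "c \<le> a" by simp
    obtain p where p: "pre_digraph.awalk G (tail G (x N)) p (tail G (u 0))" "length p = k"
      using bspec[OF bspec[OF k vert[OF x]] vert[OF u], of N 0] by blast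
    obtain z where z: "z \<in> path_space G" "tail G (z 0) = tail G (x N)" "\<And>j. z (k + j) = u j"
      using walk_then_path[OF p(1) u] p(2) by auto
    define w where "w = (\<lambda>j. if j < N then x j else z (j - N))"
    have w: "w \<in> path_space G" unfolding w_def using x z(1,2) by (rule path_join)
    have "w j \<in> Xi" if "N + k \<le> j" for j
    proof -
      have "w j = z (k + (j - N - k))" using that by (simp add: w_def)
      then show ?thesis using z(3) uXi by simp
    qed
    then have "free_between a (N + k) w
        \<in> level G H xi (card {j. j < a \<and> w j \<notin> Xi} + (N + k - a))"
      using w by (intro free_between_level) (simp_all add: N_def)
    moreover have "{j. j < a \<and> w j \<notin> Xi} = {j. j < a \<and> x j \<notin> Xi}"
      by (auto simp: w_def N_def)
    moreover have "c + (N + k - a) = l" using \<open>c \<le> a\<close> True by (simp add: N_def a_def)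
    ultimately have "free_between a (N + k) w \<in> level G H xi l" by (simp add: c_def)
    moreover have "\<forall>j<l - k. free_between a (N + k) w j = x j"
      by (simp add: free_between_def w_def a_def[symmetric] N_def)
    ultimately show ?thesis by blast
  qed
  then show thesis by (rule that)
qed

lemma approximates_exists:
  assumes x: "x \<in> path_space G" obtains xs where "approximates G H xi xs x"
proof (cases "level G H xi 0 = {}")
  case True
  then show thesis using that by (simp add: approximates_def)
next
  case False
  obtain k where "\<And>l. \<exists>z\<in>level G H xi l. \<forall>j<l - k. z j = x j"
    using approximation_exists[OF x False] by blast
  then obtain xs where xs: "\<And>l. xs l \<in> level G H xi l" "\<And>l. \<forall>j<l - k. xs l j = x j"
    by metis
  \<comment> \<open>Moving the index by \<open>k\<close> removes the truncated subtraction in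
    \<open>l - k\<close>.\<close>
  have "(\<lambda>l. seq_dist (xs (l + k)) x) \<longlonglongrightarrow> 0"
  proof (rule tendsto_sandwich[OF always_eventually always_eventually tendsto_const])
    show "\<forall>l. seq_dist (xs (l + k)) x \<le> (1 / 2) ^ l"
      using seq_dist_le[OF xs(2)] by (metis add_diff_cancel_right')
    show "(\<lambda>l. (1 / 2 :: real) ^ l) \<longlonglongrightarrow> 0" by (rule LIMSEQ_realpow_zero) auto
  qed auto
  then have "(\<lambda>l. seq_dist (xs l) x) \<longlonglongrightarrow> 0" by (rule LIMSEQ_offset)
  then show thesis using that[of xs] False xs(1) by (simp add: approximates_def)
qed

text \<open>Weaker than \<open>approximates\<close>: \<open>kappa\<close> need only be at least
  \<open>l\<close>, and only eventually. This treats both branches of \<open>approximates\<close>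
  alike and, unlike exact levels, is compatible with the shift.\<close>

definition tends :: "(nat \<Rightarrow> nat \<Rightarrow> 'e) \<Rightarrow> (nat \<Rightarrow> 'e) \<Rightarrow> bool" where
  "tends xs x \<longleftrightarrow> (\<forall>\<^sub>F l in sequentially. enat l \<le> kappa H xi (xs l)) \<and>
     (\<forall>m. \<forall>\<^sub>F l in sequentially. \<forall>j<m. xs l j = x j)"

text \<open>Beyond its last free edge a path with finitely many of them would be an element of level
  0.\<close>

lemma kappa_infinite:
  assumes "level G H xi 0 = {}" "x \<in> path_space G" shows "kappa H xi x = \<infinity>"
proof (rule ccontr)
  assume "kappa H xi x \<noteq> \<infinity>"
  then have "finite {n. x n \<notin> Xi}" by (auto simp: kappa_def Let_def split: if_splits)
  then obtain N where "\<forall>n\<in>{n. x n \<notin> Xi}. n < N" by (auto simp: finite_nat_set_iff_bounded)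
  then have "\<forall>n. (shift ^^ N) x n \<in> Xi" by (force simp: shift_funpow)
  moreover have "(shift ^^ N) x \<in> path_space G"
    using assms(2) by (simp add: path_space_def shift_funpow)
  ultimately show False
    using assms(1) kappa_eq_0_iff by (auto simp: level_def zero_enat_def[symmetric])
qed

lemma approximates_tends:
  assumes "approximates G H xi xs x" "x \<in> path_space G" shows "tends xs x"
proof (cases "level G H xi 0 = {}")
  case True
  then show ?thesis using assms kappa_infinite by (simp add: approximates_def tends_def)
next
  case False
  then have xs: "\<And>l. xs l \<in> level G H xi l" "(\<lambda>l. seq_dist (xs l) x) \<longlonglongrightarrow> 0"
    using assms(1) by (simp_all add: approximates_def)
  have "\<forall>\<^sub>F l in sequentially. \<forall>j<m. xs l j = x j" for m
  proof -
    have "\<forall>\<^sub>F l in sequentially. seq_dist (xs l) x < (1 / 2) ^ m"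
      using xs(2) by (rule order_tendstoD) simp
    then show ?thesis by eventually_elim (simp add: seq_dist_less_agree)
  qed
  then show ?thesis using xs(1) by (simp add: tends_def level_def)
qed

section \<open>The limit defining the metric\<close>

text \<open>Equivalent limits are \<open>close m\<close>, and so are the approximating terms. For
  \<open>l\<close> and \<open>l'\<close> beyond \<open>m\<close>, \<open>lam_near\<close>
  contributes 16 + 2 units of \<open>(1 / 2) ^ m\<close> and the sequence part one more. Independent
  indices yield the Cauchy property and the equality of limits together.\<close>

lemma level_dist_near:
  assumes "tends xs x" "tends ys y" "tends xs' x'" "tends ys' y'"
    and x: "(x, x') \<in> xi_rel G H xi" and y: "(y, y') \<in> xi_rel G H xi"
  shows "\<exists>N. \<forall>l\<ge>N. \<forall>l'\<ge>N. \<bar>level_dist G H xi l (xs l) (ys l) - level_dist G H xi l' (xs' l') (ys' l')\<bar>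
    \<le> 20 * (1 / 2) ^ m"
proof -
  have ev: "\<forall>\<^sub>F l in sequentially. enat l \<le> kappa H xi (zs l) \<and> (\<forall>j<m. zs l j = z j)"
    if "tends zs z" for zs z
    using that by (simp add: tends_def eventually_conj_iff)
  have "\<forall>\<^sub>F l in sequentially. m \<le> l \<and>
      (enat l \<le> kappa H xi (xs l) \<and> (\<forall>j<m. xs l j = x j)) \<and>
      (enat l \<le> kappa H xi (ys l) \<and> (\<forall>j<m. ys l j = y j)) \<and>
      (enat l \<le> kappa H xi (xs' l) \<and> (\<forall>j<m. xs' l j = x' j)) \<and>
      (enat l \<le> kappa H xi (ys' l) \<and> (\<forall>j<m. ys' l j = y' j))"
    by (intro eventually_conj ev assms eventually_ge_at_top)
  then obtain N where N: "\<And>l. N \<le> l \<Longrightarrow> m \<le> l \<and>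
      (enat l \<le> kappa H xi (xs l) \<and> (\<forall>j<m. xs l j = x j)) \<and>
      (enat l \<le> kappa H xi (ys l) \<and> (\<forall>j<m. ys l j = y j)) \<and>
      (enat l \<le> kappa H xi (xs' l) \<and> (\<forall>j<m. xs' l j = x' j)) \<and>
      (enat l \<le> kappa H xi (ys' l) \<and> (\<forall>j<m. ys' l j = y' j))"
    unfolding eventually_sequentially by blast
  show ?thesis
  proof (intro exI allI impI)
    fix l l' assume l: "N \<le> l" and l': "N \<le> l'"
    note l = N[OF l] and l' = N[OF l']
    have "close m (xs l) (xs' l')"
      using xi_rel_close[OF x, of m] l l' by (auto intro: close_cong)
    moreover have "close m (ys l) (ys' l')"
      using xi_rel_close[OF y, of m] l l' by (auto intro: close_cong)
    ultimately have "\<bar>lam H xi l (xs l) (ys l) - lam H xi l' (xs' l') (ys' l')\<bar>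
        \<le> 16 * (1 / 2) ^ m + 2 * (1 / 2) ^ min l l'"
      using l l' by (intro lam_near) auto
    also have "\<dots> \<le> 16 * (1 / 2) ^ m + 2 * (1 / 2) ^ m"
      using l l' by (intro add_left_mono mult_left_mono power_decreasing) auto
    finally have "\<bar>lam H xi l (xs l) (ys l) - lam H xi l' (xs' l') (ys' l')\<bar> \<le> 18 * (1 / 2) ^ m"
      by simp
    moreover have "\<bar>seq_dist (\<lambda>n. tau G H xi (xs l n)) (\<lambda>n. tau G H xi (ys l n)) -
        seq_dist (\<lambda>n. tau G H xi (xs' l' n)) (\<lambda>n. tau G H xi (ys' l' n))\<bar> \<le> (1 / 2) ^ m"
      using l l' xi_rel_tau[OF x] xi_rel_tau[OF y] by (intro seq_dist_near) simp_all
    ultimately have "\<bar>level_dist G H xi l (xs l) (ys l) - level_dist G H xi l' (xs' l') (ys' l')\<bar>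
        \<le> 19 * (1 / 2) ^ m"
      unfolding level_dist_def by linarith
    also have "\<dots> \<le> 20 * (1 / 2) ^ m" by simp
    finally show "\<bar>level_dist G H xi l (xs l) (ys l) - level_dist G H xi l' (xs' l') (ys' l')\<bar>
        \<le> 20 * (1 / 2) ^ m" .
  qed
qed

lemma small_power: "0 < e \<Longrightarrow> \<exists>m. 20 * (1 / 2 :: real) ^ m < e"
  using real_arch_pow_inv[of "e / 20" "1 / 2"] by (auto simp: field_simps)

lemma level_dist_convergent:
  assumes "x \<in> path_space G" "y \<in> path_space G" "tends xs x" "tends ys y"
  shows "convergent (\<lambda>l. level_dist G H xi l (xs l) (ys l))"
proof (rule Cauchy_convergent, rule CauchyI)
  fix e :: real assume "0 < e"
  then obtain m where m: "20 * (1 / 2 :: real) ^ m < e" using small_power by blast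
  obtain N where "\<And>l l'. N \<le> l \<Longrightarrow> N \<le> l' \<Longrightarrow>
      \<bar>level_dist G H xi l (xs l) (ys l) - level_dist G H xi l' (xs l') (ys l')\<bar> \<le> 20 * (1 / 2) ^ m"
    using level_dist_near[OF assms(3,4,3,4) xi_rel_refl xi_rel_refl] assms(1,2) by blast
  with m show "\<exists>M. \<forall>l\<ge>M. \<forall>n\<ge>M. norm (level_dist G H xi l (xs l) (ys l)
      - level_dist G H xi n (xs n) (ys n)) < e"
    unfolding real_norm_def by (meson le_less_trans)
qed

lemma level_dist_same_limit:
  assumes "tends xs x" "tends ys y" "tends xs' x'" "tends ys' y'"
    and "(x, x') \<in> xi_rel G H xi" "(y, y') \<in> xi_rel G H xi"
    and lim: "(\<lambda>l. level_dist G H xi l (xs l) (ys l)) \<longlonglongrightarrow> r"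
  shows "(\<lambda>l. level_dist G H xi l (xs' l) (ys' l)) \<longlonglongrightarrow> r"
proof (rule Lim_transform2[OF lim], rule LIMSEQ_I)
  fix e :: real assume "0 < e"
  then obtain m where m: "20 * (1 / 2 :: real) ^ m < e" using small_power by blast
  obtain N where N: "\<And>l l'. N \<le> l \<Longrightarrow> N \<le> l' \<Longrightarrow>
      \<bar>level_dist G H xi l (xs l) (ys l) - level_dist G H xi l' (xs' l') (ys' l')\<bar> \<le> 20 * (1 / 2) ^ m"
    using level_dist_near[OF assms(1-6)] by blast
  show "\<exists>N. \<forall>l\<ge>N. norm (level_dist G H xi l (xs l) (ys l)
      - level_dist G H xi l (xs' l) (ys' l) - 0) < e"
  proof (intro exI allI impI)
    fix l assume "N \<le> l"
    with m N[of l l] show "norm (level_dist G H xi l (xs l) (ys l)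
        - level_dist G H xi l (xs' l) (ys' l) - 0) < e" by simp
  qed
qed

text \<open>The limit exists by the Cauchy property and is the same along all admissible sequences;
  since such sequences exist, it is the only number satisfying the description in
  \<open>path_dist\<close>.\<close>

lemma path_dist_limit:
  assumes x: "x \<in> path_space G" and y: "y \<in> path_space G" and "tends xs x" "tends ys y"
  shows "(\<lambda>l. level_dist G H xi l (xs l) (ys l)) \<longlonglongrightarrow> path_dist G H xi x y"
proof -
  obtain r where r: "(\<lambda>l. level_dist G H xi l (xs l) (ys l)) \<longlonglongrightarrow> r"
    using level_dist_convergent[OF assms] unfolding convergent_def by blast
  obtain xs0 ys0 where a: "approximates G H xi xs0 x" "approximates G H xi ys0 y"
    using approximates_exists[OF x] approximates_exists[OF y] by metis
  have "path_dist G H xi x y = r"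
    unfolding path_dist_def
  proof (rule the_equality)
    show "\<forall>xs ys. approximates G H xi xs x \<longrightarrow> approximates G H xi ys y \<longrightarrow>
        (\<lambda>l. level_dist G H xi l (xs l) (ys l)) \<longlonglongrightarrow> r"
      using level_dist_same_limit[OF assms(3,4) _ _ xi_rel_refl[OF x] xi_rel_refl[OF y] r]
        approximates_tends x y by blast
    then show "s = r" if "\<forall>xs ys. approximates G H xi xs x \<longrightarrow> approximates G H xi ys y \<longrightarrow>
        (\<lambda>l. level_dist G H xi l (xs l) (ys l)) \<longlonglongrightarrow> s" for s
      using that a LIMSEQ_unique by blast
  qed
  with r show ?thesis by simp
qed

text \<open>This makes the set in \<open>xi_dist\<close> a singleton.\<close>

lemma path_dist_cong:
  assumes "(x, x') \<in> xi_rel G H xi" "(y, y') \<in> xi_rel G H xi"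
  shows "path_dist G H xi x y = path_dist G H xi x' y'"
proof -
  have paths: "x \<in> path_space G" "x' \<in> path_space G" "y \<in> path_space G" "y' \<in> path_space G"
    using assms by (auto simp: xi_rel_iff)
  obtain xs xs' ys ys' where t: "tends xs x" "tends ys y" "tends xs' x'" "tends ys' y'"
    using approximates_exists approximates_tends paths by metis
  from level_dist_same_limit[OF t assms path_dist_limit[OF paths(1,3) t(1,2)]]
    path_dist_limit[OF paths(2,4) t(3,4)]
  show ?thesis by (rule LIMSEQ_unique)
qed

lemma xi_dist_proj:
  assumes "x \<in> path_space G" "y \<in> path_space G"
  shows "xi_dist G H xi (xi_proj G H xi x) (xi_proj G H xi y) = path_dist G H xi x y"
proof -
  have "path_dist G H xi x' y' = path_dist G H xi x y"
    if "x' \<in> xi_proj G H xi x" "y' \<in> xi_proj G H xi y" for x' y'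
    using that path_dist_cong[of x x' y y'] by (simp add: xi_proj_def)
  moreover have "x \<in> xi_proj G H xi x" "y \<in> xi_proj G H xi y"
    using xi_rel_refl assms by (simp_all add: xi_proj_def)
  ultimately have "{path_dist G H xi x' y' | x' y'. x' \<in> xi_proj G H xi x \<and> y' \<in> xi_proj G H xi y}
      = {path_dist G H xi x y}"
    by blast
  then show ?thesis by (simp add: xi_dist_def)
qed

text \<open>The limit of the \<open>lam\<close> parts alone, see \<open>lam_tendsto\<close>; written
  as a difference because the limit of the sum is already known.\<close>

definition lam_limit :: "(nat \<Rightarrow> 'e) \<Rightarrow> (nat \<Rightarrow> 'e) \<Rightarrow> real" where
  "lam_limit x y = path_dist G H xi x y - seq_dist (\<lambda>n. tau G H xi (x n)) (\<lambda>n. tau G H xi (y n))"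

lemma lam_tendsto:
  assumes "x \<in> path_space G" "y \<in> path_space G" and xs: "tends xs x" and ys: "tends ys y"
  shows "(\<lambda>l. lam H xi l (xs l) (ys l)) \<longlonglongrightarrow> lam_limit x y"
proof -
  let ?s = "\<lambda>x y. seq_dist (\<lambda>n. tau G H xi (x n)) (\<lambda>n. tau G H xi (y n))"
  have "(\<lambda>l. ?s (xs l) (ys l)) \<longlonglongrightarrow> ?s x y"
  proof (rule LIMSEQ_I)
    fix e :: real assume "0 < e"
    then obtain m where "(1 / 2) ^ m < e" using real_arch_pow_inv[of e "1 / 2"] by auto
    moreover have "\<forall>\<^sub>F l in sequentially. (\<forall>j<m. xs l j = x j) \<and> (\<forall>j<m. ys l j = y j)"
      using xs ys by (simp add: tends_def eventually_conj_iff)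
    then have "\<forall>\<^sub>F l in sequentially. \<bar>?s (xs l) (ys l) - ?s x y\<bar> \<le> (1 / 2) ^ m"
      by eventually_elim (rule seq_dist_near; simp)
    ultimately show "\<exists>N. \<forall>l\<ge>N. norm (?s (xs l) (ys l) - ?s x y) < e"
      unfolding eventually_sequentially real_norm_def by (meson le_less_trans)
  qed
  from tendsto_diff[OF path_dist_limit[OF assms] this] show ?thesis
    by (simp add: lam_limit_def level_dist_def)
qed

section \<open>Expansion of the shift\<close>

lemma first_at_shift: "x 0 \<in> Xi \<Longrightarrow> first_at p x \<Longrightarrow> \<exists>q. p = Suc q \<and> first_at q (shift x)"
  by (cases p) (auto simp: first_at_def shift_def)

text \<open>The shift drops one digit, which doubles angles modulo full turns and moves the first
  free edge one place forward. So all terms double, up to the correction from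
  \<open>turn_dist_double_ge\<close>.\<close>

lemma lam_shift_fixed:
  assumes kx: "enat (Suc k) \<le> kappa H xi x" and ky: "enat (Suc k) \<le> kappa H xi y"
    and x0: "x 0 \<in> Xi" and y0: "y 0 \<in> Xi" and small: "lam H xi (Suc k) x y < 1 / 2"
  shows "2 * lam H xi (Suc k) x y - max 0 (4 * lam H xi (Suc k) x y - 1)
      \<le> lam H xi (Suc k) (shift x) (shift y)"
    and "lam H xi (Suc k) (shift x) (shift y) \<le> 2 * lam H xi (Suc k) x y"
proof -
  obtain p' q' where "first_at p' x" "first_at q' y" using kappa_SucE kx ky by metis
  then obtain p q where p: "first_at (Suc p) x" "first_at p (shift x)"
    and q: "first_at (Suc q) y" "first_at q (shift y)"
    using first_at_shift x0 y0 by metis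
  define t where "t = psum y (Suc q) - psum x (Suc p)"
  \<comment> \<open>The integer subtracted is the difference of the two digits dropped.\<close>
  have "psum (shift y) q - psum (shift x) p
      = 2 * t - of_int (of_bool (eps H xi (y 0)) - of_bool (eps H xi (x 0)))"
    by (simp add: t_def psum_shift)
  then have turn: "turn_dist (psum (shift y) q - psum (shift x) p) = turn_dist (2 * t)"
    by (simp only: turn_dist_diff_int)
  define L where "L = lam H xi k ((shift ^^ Suc (Suc p)) x) ((shift ^^ Suc (Suc q)) y)"
  define R where "R = (if p = q \<and> turn_dist t = 0 then (1 / 2) ^ (p + 4) * L else 0)"
  have lam: "lam H xi (Suc k) x y = \<bar>(1 / 2) ^ p - (1 / 2) ^ q\<bar> / 4 + turn_dist t + R"
  proof -
    have "(1 / 2 :: real) ^ Suc (Suc p) - (1 / 2) ^ Suc (Suc q) = ((1 / 2) ^ p - (1 / 2) ^ q) / 4"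
      by simp
    then have "\<bar>(1 / 2 :: real) ^ Suc (Suc p) - (1 / 2) ^ Suc (Suc q)\<bar> = \<bar>(1 / 2) ^ p - (1 / 2) ^ q\<bar> / 4"
      by (simp only: abs_divide abs_numeral)
    moreover have "Suc p + 3 = p + 4" by simp
    ultimately show ?thesis
      unfolding lam_Suc[OF p(1) q(1)] t_def[symmetric] L_def[symmetric] R_def
      by (simp only: nat.inject)
  qed
  have "0 \<le> R" using lam_bounds by (simp add: R_def L_def del: funpow.simps)
  then have le: "turn_dist t \<le> lam H xi (Suc k) x y" unfolding lam by simp
  then have "turn_dist t < 1 / 2" using small by linarith
  \<comment> \<open>Only opposite points, at distance \<open>1/2\<close>, are distinct with equal
    squares. Excluding them keeps the recursive term either present on both sides or absent on
    both.\<close>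
  then have zero: "turn_dist (2 * t) = 0 \<longleftrightarrow> turn_dist t = 0"
    using turn_dist_double_ge[of t] turn_dist_double_le[of t] turn_dist_nonneg[of t]
      turn_dist_nonneg[of "2 * t"] by (auto simp: max_def split: if_splits)
  have lam': "lam H xi (Suc k) (shift x) (shift y)
      = \<bar>(1 / 2) ^ p - (1 / 2) ^ q\<bar> / 2 + turn_dist (2 * t) + 2 * R"
  proof -
    have "(1 / 2 :: real) ^ Suc p - (1 / 2) ^ Suc q = ((1 / 2) ^ p - (1 / 2) ^ q) / 2"
      by simp
    then have "\<bar>(1 / 2 :: real) ^ Suc p - (1 / 2) ^ Suc q\<bar> = \<bar>(1 / 2) ^ p - (1 / 2) ^ q\<bar> / 2"
      by (simp only: abs_divide abs_numeral)
    \<comment> \<open>Once the first blocks are removed, both recursions continue with the same pair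
      of sequences.\<close>
    moreover have "lam H xi k ((shift ^^ Suc p) (shift x)) ((shift ^^ Suc q) (shift y)) = L"
      unfolding L_def by (simp only: funpow_Suc_right o_apply)
    moreover have "(if p = q \<and> turn_dist t = 0 then (1 / 2) ^ (p + 3) * L else 0) = 2 * R"
      by (simp add: R_def power_add power3_eq_cube power4_eq_xxxx)
    ultimately show ?thesis
      unfolding lam_Suc[OF p(2) q(2)] turn zero by (simp only:)
  qed
  have dbl: "2 * lam H xi (Suc k) x y = \<bar>(1 / 2) ^ p - (1 / 2) ^ q\<bar> / 2 + 2 * turn_dist t + 2 * R"
    unfolding lam by simp
  have "max 0 (4 * turn_dist t - 1) \<le> max 0 (4 * lam H xi (Suc k) x y - 1)"
    using le by (intro max.mono) auto
  then show "2 * lam H xi (Suc k) x y - max 0 (4 * lam H xi (Suc k) x y - 1)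
      \<le> lam H xi (Suc k) (shift x) (shift y)"
    unfolding lam' dbl using turn_dist_double_ge[of t] by linarith
  show "lam H xi (Suc k) (shift x) (shift y) \<le> 2 * lam H xi (Suc k) x y"
    unfolding lam' dbl using turn_dist_double_le[of t] by linarith
qed

text \<open>The first blocks are empty, so the leading terms vanish and the recursive factor is
  \<open>(1 / 2) ^ 3\<close>.\<close>

lemma lam_shift_free:
  assumes "x 0 \<notin> Xi" "y 0 \<notin> Xi"
  shows "lam H xi k (shift x) (shift y) = 8 * lam H xi (Suc k) x y"
proof -
  have "first_at 0 x" "first_at 0 y" using assms by (simp_all add: first_at_def)
  then show ?thesis
    unfolding lam_Suc[OF \<open>first_at 0 x\<close> \<open>first_at 0 y\<close>]
    by (simp add: turn_dist_def power3_eq_cube del: lam.simps)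
qed

text \<open>The shift may lose one free edge, hence the advanced index on the left.\<close>

lemma tends_shift_Suc:
  assumes "tends xs x" shows "tends (\<lambda>l. shift (xs (Suc l))) (shift x)"
proof -
  have "kappa H xi z \<le> eSuc (kappa H xi (shift z))" for z
    by (subst kappa_shift) (auto intro: ile_eSuc)
  then have "enat l \<le> kappa H xi (shift z)" if "enat (Suc l) \<le> kappa H xi z" for l z
    using that order_trans eSuc_ile_mono eSuc_enat by metis
  moreover have "\<forall>\<^sub>F l in sequentially. enat (Suc l) \<le> kappa H xi (xs (Suc l))"
    using assms eventually_sequentially_Suc[of "\<lambda>l. enat l \<le> kappa H xi (xs l)"]
    by (simp add: tends_def)
  ultimately have "\<forall>\<^sub>F l in sequentially. enat l \<le> kappa H xi (shift (xs (Suc l)))"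
    by (auto elim: eventually_mono)
  moreover have "\<forall>\<^sub>F l in sequentially. \<forall>j<m. shift (xs (Suc l)) j = shift x j" for m
  proof -
    have "\<forall>\<^sub>F l in sequentially. \<forall>j<Suc m. xs (Suc l) j = x j"
      using assms eventually_sequentially_Suc[of "\<lambda>l. \<forall>j<Suc m. xs l j = x j"]
      by (simp add: tends_def)
    then show ?thesis by eventually_elim (simp add: shift_def)
  qed
  ultimately show ?thesis by (simp add: tends_def)
qed

lemma tends_first: "tends xs x \<Longrightarrow> \<forall>\<^sub>F l in sequentially. xs l 0 = x 0"
  unfolding tends_def by (auto elim!: allE[of _ "1 :: nat"])

text \<open>The edge removed lies in \<open>Xi\<close>, so \<open>kappa\<close> is unchanged and the
  index can stay.\<close>

lemma tends_shift:
  assumes "tends xs x" "x 0 \<in> Xi" shows "tends (\<lambda>l. shift (xs l)) (shift x)"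
proof -
  have "\<forall>\<^sub>F l in sequentially. enat l \<le> kappa H xi (xs l)" using assms by (simp add: tends_def)
  then have "\<forall>\<^sub>F l in sequentially. enat l \<le> kappa H xi (shift (xs l))"
    using tends_first[OF assms(1)]
  proof eventually_elim
    case (elim l)
    then show ?case using assms(2) kappa_shift[of "xs l"] by simp
  qed
  moreover have "\<forall>\<^sub>F l in sequentially. \<forall>j<m. shift (xs l) j = shift x j" for m
  proof -
    have "\<forall>\<^sub>F l in sequentially. \<forall>j<Suc m. xs l j = x j" using assms by (simp add: tends_def)
    then show ?thesis by eventually_elim (simp add: shift_def)
  qed
  ultimately show ?thesis by (simp add: tends_def)
qed

lemma lam_limit_shift_free:
  assumes x: "x \<in> path_space G" and y: "y \<in> path_space G" and free: "x 0 \<notin> Xi" "y 0 \<notin> Xi"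
  shows "lam_limit (shift x) (shift y) = 8 * lam_limit x y"
proof -
  obtain xs ys where t: "tends xs x" "tends ys y"
    using approximates_exists approximates_tends x y by metis
  have "(\<lambda>l. 8 * lam H xi (Suc l) (xs (Suc l)) (ys (Suc l))) \<longlonglongrightarrow> 8 * lam_limit x y"
    by (intro tendsto_mult_left LIMSEQ_Suc[OF lam_tendsto] x y t)
  moreover have "\<forall>\<^sub>F l in sequentially. xs (Suc l) 0 = x 0 \<and> ys (Suc l) 0 = y 0"
    using tends_first[OF t(1)] tends_first[OF t(2)]
    by (simp only: eventually_sequentially_Suc[of "\<lambda>l. xs l 0 = x 0 \<and> ys l 0 = y 0"]
      eventually_conj)
  then have "\<forall>\<^sub>F l in sequentially. 8 * lam H xi (Suc l) (xs (Suc l)) (ys (Suc l))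
      = lam H xi l (shift (xs (Suc l))) (shift (ys (Suc l)))"
    by eventually_elim (use free lam_shift_free in metis)
  ultimately have "(\<lambda>l. lam H xi l (shift (xs (Suc l))) (shift (ys (Suc l)))) \<longlonglongrightarrow> 8 * lam_limit x y"
    by (rule Lim_transform_eventually)
  moreover have "(\<lambda>l. lam H xi l (shift (xs (Suc l))) (shift (ys (Suc l))))
      \<longlonglongrightarrow> lam_limit (shift x) (shift y)"
    by (intro lam_tendsto shift_in_path_space tends_shift_Suc x y t)
  ultimately show ?thesis using LIMSEQ_unique by blast
qed

text \<open>
  The limit may be \<open>1/4\<close> although the approximating terms exceed \<open>1/4\<close>, where doubling an
  angle no longer doubles its distance from the integers. The error term of
  \<open>lam_shift_fixed\<close> vanishes in the limit.
\<close>
lemma lam_limit_shift_fixed: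
  assumes x: "x \<in> path_space G" and y: "y \<in> path_space G" and fixed: "x 0 \<in> Xi" "y 0 \<in> Xi"
    and small: "lam_limit x y \<le> 1 / 4"
  shows "lam_limit (shift x) (shift y) = 2 * lam_limit x y"
proof -
  obtain xs ys where t: "tends xs x" "tends ys y"
    using approximates_exists approximates_tends x y by metis
  let ?a = "\<lambda>l. lam H xi l (xs l) (ys l)" and ?b = "\<lambda>l. lam H xi l (shift (xs l)) (shift (ys l))"
  have a: "?a \<longlonglongrightarrow> lam_limit x y" by (rule lam_tendsto[OF x y t])
  have b: "?b \<longlonglongrightarrow> lam_limit (shift x) (shift y)"
    by (intro lam_tendsto shift_in_path_space tends_shift x y t fixed)
  have "\<forall>\<^sub>F l in sequentially. ?a l < 1 / 2" using a small by (intro order_tendstoD(2)) auto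
  moreover have "\<forall>\<^sub>F l in sequentially. enat l \<le> kappa H xi (xs l)"
    "\<forall>\<^sub>F l in sequentially. enat l \<le> kappa H xi (ys l)"
    using t by (simp_all add: tends_def)
  ultimately have ev: "\<forall>\<^sub>F l in sequentially. 2 * ?a l - max 0 (4 * ?a l - 1) \<le> ?b l \<and> ?b l \<le> 2 * ?a l"
    using tends_first[OF t(1)] tends_first[OF t(2)] eventually_gt_at_top[of 0]
  proof eventually_elim
    case (elim l)
    then obtain k where "l = Suc k" by (metis gr0_implies_Suc)
    with elim fixed lam_shift_fixed[of k "xs l" "ys l"] show ?case by simp
  qed
  have "(\<lambda>l. 2 * ?a l - max 0 (4 * ?a l - 1)) \<longlonglongrightarrow> 2 * lam_limit x y - max 0 (4 * lam_limit x y - 1)"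
    by (intro tendsto_intros a)
  then have "2 * lam_limit x y - max 0 (4 * lam_limit x y - 1) \<le> lam_limit (shift x) (shift y)"
    using ev by (intro tendsto_le[OF _ b]) (auto elim: eventually_mono)
  moreover have "lam_limit (shift x) (shift y) \<le> 2 * lam_limit x y"
    using ev by (intro tendsto_le[OF _ tendsto_mult_left[OF a] b]) (auto elim: eventually_mono)
  ultimately show ?thesis using small by simp
qed

lemma lam_limit_nonneg:
  assumes "x \<in> path_space G" "y \<in> path_space G" shows "0 \<le> lam_limit x y"
proof -
  obtain xs ys where "tends xs x" "tends ys y"
    using approximates_exists approximates_tends assms by metis
  from lam_tendsto[OF assms this] show ?thesis
    using lam_bounds by (intro LIMSEQ_le_const) auto
qed

text \<open>The first edges agree in the quotient graph, so both lie in \<open>Xi\<close> or both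
  are free. The sequence part doubles and the \<open>lam\<close> part grows by 2 or by 8, so their
  sum grows by a factor between 2 and 8.\<close>

lemma path_dist_shift:
  assumes x: "x \<in> path_space G" and y: "y \<in> path_space G"
    and small: "path_dist G H xi x y \<le> 1 / 4"
  shows "2 * path_dist G H xi x y \<le> path_dist G H xi (shift x) (shift y)
    \<and> path_dist G H xi (shift x) (shift y) \<le> 8 * path_dist G H xi x y"
proof -
  let ?tau = "\<lambda>x n. tau G H xi (x n)"
  have split: "path_dist G H xi x y = seq_dist (?tau x) (?tau y) + lam_limit x y" for x y
    by (simp add: lam_limit_def)
  have nonneg: "0 \<le> lam_limit x y" by (rule lam_limit_nonneg[OF x y])
  \<comment> \<open>Since the \<open>lam\<close> part is nonnegative, the sequence part is at most
    \<open>1/4\<close>, and any distance below 1 forces equal first entries.\<close>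
  then have "seq_dist (?tau x) (?tau y) < (1 / 2) ^ 0" using small unfolding split by simp
  then have tau0: "tau G H xi (x 0) = tau G H xi (y 0)" by (rule seq_dist_less_agree) simp
  then have "seq_dist (shift (?tau x)) (shift (?tau y)) = 2 * seq_dist (?tau x) (?tau y)"
    by (rule seq_dist_shift)
  then have sd: "seq_dist (?tau (shift x)) (?tau (shift y)) = 2 * seq_dist (?tau x) (?tau y)"
    by (simp add: shift_def)
  have "x 0 \<in> arcs G" "y 0 \<in> arcs G" using x y by (simp_all add: path_space_def)
  with tau0 have Xi: "x 0 \<in> Xi \<longleftrightarrow> y 0 \<in> Xi" by (auto simp: tau_eq_iff)
  have "lam_limit x y \<le> 1 / 4"
    using small seq_dist_nonneg[of "?tau x" "?tau y"] unfolding split by linarith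
  then have "lam_limit (shift x) (shift y) \<in> {2 * lam_limit x y, 8 * lam_limit x y}"
    using lam_limit_shift_fixed[OF x y] lam_limit_shift_free[OF x y] Xi by blast
  then show ?thesis
    unfolding split sd using nonneg seq_dist_nonneg[of "?tau x" "?tau y"] by auto
qed

end

theorem theorem3p17:
  fixes G :: "('v, 'e) pre_digraph" and H :: "('w, 'f) pre_digraph"
    and xi :: "bool \<Rightarrow> ('w, 'f, 'v, 'e) graph_map"
    and x y :: "(nat \<Rightarrow> 'e) set"
  assumes "fin_digraph G" and "fin_digraph H"
    and "graph_embedding H G (xi False)" and "graph_embedding H G (xi True)"
    and "standing_hypotheses G H xi"
    and "x \<in> xi_space G H xi" and "y \<in> xi_space G H xi"
    and "xi_dist G H xi x y \<le> 1 / 2 ^ 2"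
  shows "2 * xi_dist G H xi x y \<le> xi_dist G H xi (xi_shift G H xi x) (xi_shift G H xi y)
    \<and> xi_dist G H xi (xi_shift G H xi x) (xi_shift G H xi y) \<le> 8 * xi_dist G H xi x y"
proof -
  have "graph_embedding H G (xi j)" for j using assms(3,4) by (cases j) simp_all
  then interpret xi_system G H xi using assms(1,2,5) by (intro xi_system.intro)
  from assms(6) obtain a where a: "a \<in> path_space G" and x: "x = xi_proj G H xi a"
    unfolding xi_space_def xi_proj_def by (rule quotientE)
  from assms(7) obtain b where b: "b \<in> path_space G" and y: "y = xi_proj G H xi b"
    unfolding xi_space_def xi_proj_def by (rule quotientE)
  have "path_dist G H xi a b \<le> 1 / 4"
    using assms(8) by (simp add: x y xi_dist_proj[OF a b])
  from path_dist_shift[OF a b this] show ?thesis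
    by (simp add: x y xi_dist_proj[OF a b] xi_shift_proj a b
      xi_dist_proj[OF shift_in_path_space[OF a] shift_in_path_space[OF b]])
qed

end
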